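(* Let $n\ge1$ and let $\nabla$ be a statistical connection on the Takano Gaussian space $(\mathcal N_T,g^F)$, $\mathcal N_T=\mathbb{R}_{>0}\times\mathbb{R}^n$. Then $\nabla$ is the Amari--Chentsov $\alpha$-connection $\nabla^{A(\alpha)}$ for some $\alpha\in\mathbb{R}$ if and only if the following two properties hold: (1) the statistical structure $(g^F,\nabla)$ is conjugate symmetric; (2) $\nabla$ is $\mathbb{R}_{>0}\ltimes\mathbb{R}^n$-invariant.
   Context: A statistical structure on a manifold $M$ is a pair $(g,\nabla)$ of a Riemannian metric $g$ and a torsion-free affine connection $\nabla$ such that $(X,Y,Z)\mapsto(\nabla_X g)(Y,Z)$ is totally symmetric; then $\nabla$ is called a statistical connection on $(M,g)$. For fixed $g$, $\nabla\mapsto\nabla g$ is a bijection from statistical connections onto symmetric $(0,3)$-tensor fields. The dual connection $\overline\nabla$ is defined by $Xg(Y,Z)=g(\nabla_XY,Z)+g(Y,\overline\nabla_XZ)$, and $(g,\nabla)$ is conjugate symmetric if the curvature tensors satisfy $R^\nabla=R^{\overline\nabla}$. For $(\Sigma,\mu)\in\mathcal N_T=\mathbb{R}_{>0}\times\mathbb{R}^n$ let $N(x\mid\Sigma,\mu)=(2\pi\Sigma)^{-n/2}\exp(-\frac1{2\Sigma}|x-\mu|^2)$, $x\in\mathbb{R}^n$ (the normal density with mean $\mu$ and covariance $\Sigma I_n$). The Fisher metric is $g^F_{\hat\theta}(X,Y)=\int_{\mathbb{R}^n}(X\log N(x\mid\theta))(Y\log N(x\mid\theta))N(x\mid\hat\theta)\,dx$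 and the Amari--Chentsov $\alpha$-tensor field is $C^{A(\alpha)}_{\hat\theta}(X,Y,Z)=\alpha\int_{\mathbb{R}^n}(X\log N(x\mid\theta))(Y\log N(x\mid\theta))(Z\log N(x\mid\theta))N(x\mid\hat\theta)\,dx$, for $\hat\theta\in\mathcal N_T$ and $X,Y,Z\in T_{\hat\theta}\mathcal N_T$. $\nabla^{A(\alpha)}$ is the statistical connection on $(\mathcal N_T,g^F)$ with $\nabla^{A(\alpha)}g^F=C^{A(\alpha)}$. $(\mathcal N_T,g^F)$ is called the Takano Gaussian space. The group $\mathbb{R}_{>0}\ltimes\mathbb{R}^n$ (maps $x\mapsto ax+b$, $a>0$, $b\in\mathbb{R}^n$) acts simply-transitively on $\mathcal N_T$ by push-forward of measures, i.e. $(a,b).(\Sigma,\mu)=(a^2\Sigma,a\mu+b)$. *)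

theory Defs
  imports "HOL-Analysis.Analysis"
begin

section \<open>Tensor calculus on an open subset of a Euclidean space\<close>

text \<open>
  An open subset \<open>U\<close> of a Euclidean space \<open>'a\<close> is regarded as a manifold with all tangent spaces
  identified with \<open>'a\<close>. Functions, vector fields and tensor fields on \<open>U\<close> are represented by
  functions on the whole type of which only the values on \<open>U\<close> matter; equalities between them are
  therefore always stated pointwise on \<open>U\<close>. All definitions are meant for open \<open>U\<close>.
\<close>

primrec Ck_on :: "nat \<Rightarrow> 'a::euclidean_space set \<Rightarrow> ('a \<Rightarrow> 'b::real_normed_vector) \<Rightarrow> bool" where
  "Ck_on 0 U f \<longleftrightarrow> continuous_on U f"
| "Ck_on (Suc k) U f \<longleftrightarrow>
     (\<forall>p\<in>U. f differentiable (at p)) \<and> (\<forall>v. Ck_on k U (\<lambda>p. frechet_derivative f (at p) v))"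

definition smooth_on :: "'a::euclidean_space set \<Rightarrow> ('a \<Rightarrow> 'b::real_normed_vector) \<Rightarrow> bool" where
  "smooth_on U f \<longleftrightarrow> (\<forall>k. Ck_on k U f)"

definition vector_fields :: "'a::euclidean_space set \<Rightarrow> ('a \<Rightarrow> 'a) set" where
  "vector_fields U = {X. smooth_on U X}"

definition dir_deriv :: "('a::euclidean_space \<Rightarrow> 'a) \<Rightarrow> ('a \<Rightarrow> 'b::real_normed_vector) \<Rightarrow> 'a \<Rightarrow> 'b" where
  "dir_deriv X f p = frechet_derivative f (at p) (X p)"

definition lie_bracket :: "('a::euclidean_space \<Rightarrow> 'a) \<Rightarrow> ('a \<Rightarrow> 'a) \<Rightarrow> 'a \<Rightarrow> 'a" where
  "lie_bracket X Y p = dir_deriv X Y p - dir_deriv Y X p"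

type_synonym 'a conn = "('a \<Rightarrow> 'a) \<Rightarrow> ('a \<Rightarrow> 'a) \<Rightarrow> 'a \<Rightarrow> 'a"

type_synonym 'a metric = "'a \<Rightarrow> 'a \<Rightarrow> 'a \<Rightarrow> real"

text \<open>
  The second condition says that \<open>D\<close> is well defined on vector fields on \<open>U\<close>, i.e. that
  \<open>D X Y\<close> on \<open>U\<close> only depends on the values of \<open>X\<close> and \<open>Y\<close> on \<open>U\<close>. Real homogeneity in the
  second argument is the Leibniz rule for constant \<open>f\<close>.
\<close>

definition affine_connection :: "'a::euclidean_space set \<Rightarrow> 'a conn \<Rightarrow> bool" where
  "affine_connection U D \<longleftrightarrow>
     (\<forall>X\<in>vector_fields U. \<forall>Y\<in>vector_fields U. D X Y \<in> vector_fields U) \<and>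
     (\<forall>X\<in>vector_fields U. \<forall>X'\<in>vector_fields U. \<forall>Y\<in>vector_fields U. \<forall>Y'\<in>vector_fields U.
        (\<forall>p\<in>U. X p = X' p \<and> Y p = Y' p) \<longrightarrow> (\<forall>p\<in>U. D X Y p = D X' Y' p)) \<and>
     (\<forall>X\<in>vector_fields U. \<forall>X'\<in>vector_fields U. \<forall>Y\<in>vector_fields U. \<forall>p\<in>U.
        D (\<lambda>q. X q + X' q) Y p = D X Y p + D X' Y p) \<and>
     (\<forall>f::'a \<Rightarrow> real. \<forall>X\<in>vector_fields U. \<forall>Y\<in>vector_fields U. smooth_on U f \<longrightarrow>
        (\<forall>p\<in>U. D (\<lambda>q. f q *\<^sub>R X q) Y p = f p *\<^sub>R D X Y p)) \<and>
     (\<forall>X\<in>vector_fields U. \<forall>Y\<in>vector_fields U. \<forall>Y'\<in>vector_fields U. \<forall>p\<in>U.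
        D X (\<lambda>q. Y q + Y' q) p = D X Y p + D X Y' p) \<and>
     (\<forall>f::'a \<Rightarrow> real. \<forall>X\<in>vector_fields U. \<forall>Y\<in>vector_fields U. smooth_on U f \<longrightarrow>
        (\<forall>p\<in>U. D X (\<lambda>q. f q *\<^sub>R Y q) p = dir_deriv X f p *\<^sub>R Y p + f p *\<^sub>R D X Y p))"

definition torsion_free :: "'a::euclidean_space set \<Rightarrow> 'a conn \<Rightarrow> bool" where
  "torsion_free U D \<longleftrightarrow>
     (\<forall>X\<in>vector_fields U. \<forall>Y\<in>vector_fields U. \<forall>p\<in>U. D X Y p - D Y X p = lie_bracket X Y p)"

definition curvature :: "'a::euclidean_space conn \<Rightarrow> ('a \<Rightarrow> 'a) \<Rightarrow> ('a \<Rightarrow> 'a) \<Rightarrow> ('a \<Rightarrow> 'a) \<Rightarrow> 'a \<Rightarrow> 'a"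
  where "curvature D X Y Z p = D X (D Y Z) p - D Y (D X Z) p - D (lie_bracket X Y) Z p"

definition riemannian_metric :: "'a::euclidean_space set \<Rightarrow> 'a metric \<Rightarrow> bool" where
  "riemannian_metric U g \<longleftrightarrow>
     (\<forall>p\<in>U. bilinear (g p) \<and> (\<forall>u v. g p u v = g p v u) \<and> (\<forall>v. v \<noteq> 0 \<longrightarrow> g p v v > 0)) \<and>
     (\<forall>u v. smooth_on U (\<lambda>p. g p u v))"

definition cov_deriv_metric ::
    "'a::euclidean_space conn \<Rightarrow> 'a metric \<Rightarrow> ('a \<Rightarrow> 'a) \<Rightarrow> ('a \<Rightarrow> 'a) \<Rightarrow> ('a \<Rightarrow> 'a) \<Rightarrow> 'a \<Rightarrow> real" where
  "cov_deriv_metric D g X Y Z p =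
     dir_deriv X (\<lambda>q. g q (Y q) (Z q)) p - g p (D X Y p) (Z p) - g p (Y p) (D X Z p)"

definition statistical_structure :: "'a::euclidean_space set \<Rightarrow> 'a metric \<Rightarrow> 'a conn \<Rightarrow> bool" where
  "statistical_structure U g D \<longleftrightarrow>
     riemannian_metric U g \<and> affine_connection U D \<and> torsion_free U D \<and>
     (\<forall>X\<in>vector_fields U. \<forall>Y\<in>vector_fields U. \<forall>Z\<in>vector_fields U. \<forall>p\<in>U.
        cov_deriv_metric D g X Y Z p = cov_deriv_metric D g Y X Z p \<and>
        cov_deriv_metric D g X Y Z p = cov_deriv_metric D g X Z Y p)"

definition dual_connection :: "'a::euclidean_space set \<Rightarrow> 'a metric \<Rightarrow> 'a conn \<Rightarrow> 'a conn \<Rightarrow> bool" where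
  "dual_connection U g D D' \<longleftrightarrow>
     affine_connection U D' \<and>
     (\<forall>X\<in>vector_fields U. \<forall>Y\<in>vector_fields U. \<forall>Z\<in>vector_fields U. \<forall>p\<in>U.
        dir_deriv X (\<lambda>q. g q (Y q) (Z q)) p = g p (D X Y p) (Z p) + g p (Y p) (D' X Z p))"

text \<open>
  For a Riemannian metric and an affine connection the dual connection exists and is unique on
  vector fields on \<open>U\<close>, so the existential quantifier merely names it.
\<close>

definition conjugate_symmetric :: "'a::euclidean_space set \<Rightarrow> 'a metric \<Rightarrow> 'a conn \<Rightarrow> bool" where
  "conjugate_symmetric U g D \<longleftrightarrow>
     (\<exists>D'. dual_connection U g D D' \<and>
        (\<forall>X\<in>vector_fields U. \<forall>Y\<in>vector_fields U. \<forall>Z\<in>vector_fields U. \<forall>p\<in>U.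
           curvature D X Y Z p = curvature D' X Y Z p))"

definition pushforward_field ::
    "'a::euclidean_space set \<Rightarrow> ('a \<Rightarrow> 'a) \<Rightarrow> ('a \<Rightarrow> 'a) \<Rightarrow> 'a \<Rightarrow> 'a" where
  "pushforward_field U \<phi> X q =
     frechet_derivative \<phi> (at (inv_into U \<phi> q)) (X (inv_into U \<phi> q))"

text \<open>\<open>G\<close> is a set of diffeomorphisms of \<open>U\<close>.\<close>

definition invariant_connection ::
    "'a::euclidean_space set \<Rightarrow> ('a \<Rightarrow> 'a) set \<Rightarrow> 'a conn \<Rightarrow> bool" where
  "invariant_connection U G D \<longleftrightarrow>
     (\<forall>\<phi>\<in>G. \<forall>X\<in>vector_fields U. \<forall>Y\<in>vector_fields U. \<forall>p\<in>U.
        D (pushforward_field U \<phi> X) (pushforward_field U \<phi> Y) p = pushforward_field U \<phi> (D X Y) p)"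


section \<open>The Takano Gaussian space\<close>

text \<open>A point is a pair of the variance and the mean; the covariance matrix is a scalar matrix.\<close>

definition takano_space :: "(real \<times> (real ^ 'n)) set" where
  "takano_space = {0<..} \<times> UNIV"

definition gauss_density :: "real \<times> (real ^ 'n) \<Rightarrow> real ^ 'n \<Rightarrow> real" where
  "gauss_density \<theta> x =
     (2 * pi * fst \<theta>) powr (- real CARD('n) / 2) * exp (- (norm (x - snd \<theta>))\<^sup>2 / (2 * fst \<theta>))"

definition score :: "real \<times> (real ^ 'n) \<Rightarrow> real \<times> (real ^ 'n) \<Rightarrow> real ^ 'n \<Rightarrow> real" where
  "score \<theta> u x = frechet_derivative (\<lambda>\<theta>'. ln (gauss_density \<theta>' x)) (at \<theta>) u"

definition fisher_metric :: "(real \<times> (real ^ 'n)) metric" where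
  "fisher_metric \<theta> u v = (LINT x|lborel. score \<theta> u x * score \<theta> v x * gauss_density \<theta> x)"

definition amari_chentsov_tensor ::
    "real \<Rightarrow> real \<times> (real ^ 'n) \<Rightarrow> real \<times> (real ^ 'n) \<Rightarrow> real \<times> (real ^ 'n) \<Rightarrow> real \<times> (real ^ 'n) \<Rightarrow> real" where
  "amari_chentsov_tensor \<alpha> \<theta> u v w =
     \<alpha> * (LINT x|lborel. score \<theta> u x * score \<theta> v x * score \<theta> w x * gauss_density \<theta> x)"

text \<open>
  The Amari--Chentsov connection is characterised by its defining property, which determines
  it uniquely on vector fields on the Takano Gaussian space.
\<close>

definition amari_chentsov_connection :: "real \<Rightarrow> (real \<times> (real ^ 'n)) conn \<Rightarrow> bool" where
  "amari_chentsov_connection \<alpha> D \<longleftrightarrow>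
     statistical_structure takano_space fisher_metric D \<and>
     (\<forall>X\<in>vector_fields takano_space. \<forall>Y\<in>vector_fields takano_space.
      \<forall>Z\<in>vector_fields takano_space. \<forall>p\<in>takano_space.
        cov_deriv_metric D fisher_metric X Y Z p = amari_chentsov_tensor \<alpha> p (X p) (Y p) (Z p))"

definition affine_action :: "real \<Rightarrow> real ^ 'n \<Rightarrow> real \<times> (real ^ 'n) \<Rightarrow> real \<times> (real ^ 'n)" where
  "affine_action a b \<theta> = (a\<^sup>2 * fst \<theta>, a *\<^sub>R snd \<theta> + b)"

text \<open>The action is the push-forward of normal distributions under the maps \<open>x \<mapsto> a x + b\<close>:\<close>

lemma distr_gauss_affine:
  fixes b :: "real ^ 'n"
  assumes a: "a > 0" and \<theta>: "\<theta> \<in> takano_space"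
  shows "distr (density lborel (gauss_density \<theta>)) borel (\<lambda>x. a *\<^sub>R x + b) =
         density lborel (gauss_density (affine_action a b \<theta>))"
proof -
  define T where "T = (\<lambda>x::real ^ 'n. b + a *\<^sub>R x)"
  let ?f = "gauss_density (affine_action a b \<theta>)"
  have S: "fst \<theta> > 0"
    using \<theta> by (auto simp: takano_space_def)
  have [measurable]: "gauss_density \<theta>' \<in> borel_measurable borel" for \<theta>' :: "real \<times> (real ^ 'n)"
    unfolding gauss_density_def by measurable
  have [measurable]: "T \<in> borel_measurable borel"
    unfolding T_def by measurable
  have pw: "\<bar>a\<bar> ^ CARD('n) * ?f (T x) = gauss_density \<theta> x" for x
  proof -
    have "T x - (a *\<^sub>R snd \<theta> + b) = a *\<^sub>R (x - snd \<theta>)"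
      by (simp add: T_def algebra_simps)
    then have "norm (T x - (a *\<^sub>R snd \<theta> + b)) = a * norm (x - snd \<theta>)"
      using a by simp
    then have e: "(norm (T x - (a *\<^sub>R snd \<theta> + b)))\<^sup>2 / (2 * (a\<^sup>2 * fst \<theta>)) =
        (norm (x - snd \<theta>))\<^sup>2 / (2 * fst \<theta>)"
      using a by (simp add: power_mult_distrib)
    have "(2 * pi * (a\<^sup>2 * fst \<theta>)) powr (- real CARD('n) / 2) =
        (a\<^sup>2) powr (- real CARD('n) / 2) * (2 * pi * fst \<theta>) powr (- real CARD('n) / 2)"
      using a S by (subst powr_mult [symmetric]) (auto simp: ac_simps)
    also have "(a\<^sup>2) powr (- real CARD('n) / 2) = a powr (- real CARD('n))"
      using a by (subst powr_numeral [symmetric]) (auto simp: powr_powr simp del: powr_numeral)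
    also have "\<dots> = inverse (a ^ CARD('n))"
      using a by (simp add: powr_minus powr_realpow)
    finally show ?thesis
      using a e by (simp add: gauss_density_def affine_action_def)
  qed
  have "density lborel ?f =
      density (density (distr lborel borel T) (\<lambda>_. ennreal (\<bar>a\<bar> ^ CARD('n)))) ?f"
    using a lborel_affine[of a b] by (simp add: T_def)
  also have "\<dots> = density (distr lborel borel T) (\<lambda>x. ennreal (\<bar>a\<bar> ^ CARD('n)) * ennreal (?f x))"
    by (subst density_density_eq) auto
  also have "\<dots> = distr (density lborel (\<lambda>x. ennreal (\<bar>a\<bar> ^ CARD('n)) * ennreal (?f (T x)))) borel T"
    by (subst density_distr) auto
  also have "(\<lambda>x. ennreal (\<bar>a\<bar> ^ CARD('n)) * ennreal (?f (T x))) = (\<lambda>x. ennreal (gauss_density \<theta> x))"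
    by (rule ext, subst pw [symmetric], subst ennreal_mult') auto
  finally show ?thesis
    by (simp add: T_def add.commute)
qed

definition affine_group :: "(real \<times> (real ^ 'n) \<Rightarrow> real \<times> (real ^ 'n)) set" where
  "affine_group = {affine_action a b | a b. a > 0}"

end

theory Submission
  imports Defs "HOL-Probability.Distributions" "HOL-Computational_Algebra.Polynomial"
begin

text \<open>
  A connection on an open subset of a Euclidean space is the flat derivative plus its Christoffel
  symbols, that is, its values on constant vector fields. The curvature is then the curvature of the
  flat derivative plus an expression in the Christoffel symbols, and the covariant derivative of a
  metric is a tensor. So everything about \<open>D\<close> becomes a statement about the bilinear maps
  \<open>christoffel D p\<close>.

  The score functions of the Gaussian family are sums over the coordinates of centred quadratic
  polynomials in one variable. Second and third cumulants of independent variables add up, hence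
  for tangent vectors \<open>u = (s, m)\<close>, \<open>u' = (s', m')\<close>, \<open>u'' = (s'', m'')\<close> at \<open>(\<Sigma>, \<mu>)\<close>, in dimension \<open>n\<close>,
  \<open>g(u, u') = n s s' / (2 \<Sigma>\<^sup>2) + m \<bullet> m' / \<Sigma>\<close>, and the Amari--Chentsov tensor is \<open>\<alpha>\<close> times
  \<open>n s s' s'' / \<Sigma>\<^sup>3 + (s (m' \<bullet> m'') + s' (m \<bullet> m'') + s'' (m \<bullet> m')) / \<Sigma>\<^sup>2\<close>. This yields explicit
  Christoffel symbols \<open>alpha_christoffel \<alpha>\<close> for the \<open>\<alpha>\<close>-connection; \<open>\<alpha> = 0\<close> is the Levi-Civita
  connection.

  Write \<open>\<Gamma> = \<Gamma>\<^sup>0 + K\<close> with \<open>\<Gamma>\<^sup>0\<close> the Levi-Civita symbols. The condition that \<open>D\<close> is statistical says that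
  \<open>g(K(u, v), w)\<close> is totally symmetric, the covariant derivative of \<open>g\<close> is \<open>-2 g(K(u, v), w)\<close>, and the
  dual connection has the symbols \<open>\<Gamma>\<^sup>0 - K\<close>. In particular the dual of the \<open>\<alpha>\<close>-connection is the
  \<open>(-\<alpha>)\<close>-connection. Its curvature is an even function of \<open>\<alpha>\<close> and its symbols are equivariant under the
  affine group, so \<open>\<alpha>\<close>-connections are conjugate symmetric and invariant.

  For the converse, the terms of the curvature quadratic in \<open>K\<close> are the same for \<open>\<Gamma>\<^sup>0 + K\<close> and
  \<open>\<Gamma>\<^sup>0 - K\<close>, so conjugate symmetry is the linear Codazzi equation, the symmetry of the
  Levi-Civita derivative \<open>(\<nabla>\<^sup>0\<^sub>u K)(v, w)\<close> in \<open>u\<close> and \<open>v\<close>. The affine group acts simply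
  transitively, so an invariant \<open>K\<close> is determined by its value at \<open>(1, 0)\<close>, and its derivatives there are
  algebraic expressions in this value. With \<open>e = (1, 0)\<close> and \<open>h m = (0, m)\<close> the Codazzi equation for
  \<open>(e, h m)\<close> leaves a one-dimensional space: \<open>K(e, e) = \<kappa> e\<close>, \<open>K(h m, e) = \<kappa>/2 h m\<close>,
  \<open>K(h m, h m') = \<kappa> (m \<bullet> m') / n e\<close>. This is the value at \<open>(1, 0)\<close> of the tensor of the \<open>\<alpha>\<close>-connection
  with \<open>\<alpha> = -\<kappa>\<close>.
\<close>


section \<open>Smooth maps on open sets\<close>

lemma has_derivative_frechet:
  "f differentiable (at p) \<Longrightarrow> (f has_derivative frechet_derivative f (at p)) (at p)"
  by (simp add: frechet_derivative_works)

lemma has_derivative_cong_on: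
  assumes "open U" "p \<in> U" "\<And>q. q \<in> U \<Longrightarrow> f q = g q"
  shows "(f has_derivative d) (at p) \<longleftrightarrow> (g has_derivative d) (at p)"
proof
  show "(g has_derivative d) (at p)" if "(f has_derivative d) (at p)"
    by (rule has_derivative_transform_within_open[OF that assms])
  show "(f has_derivative d) (at p)" if "(g has_derivative d) (at p)"
    by (rule has_derivative_transform_within_open[OF that assms(1,2)]) (simp add: assms(3))
qed

lemma frechet_derivative_cong_on:
  assumes "open U" "p \<in> U" "\<And>q. q \<in> U \<Longrightarrow> f q = g q"
  shows "frechet_derivative f (at p) = frechet_derivative g (at p)"
proof -
  have "(f has_derivative d) (at p) \<longleftrightarrow> (g has_derivative d) (at p)" for d
    by (rule has_derivative_cong_on[OF assms])
  then show ?thesis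
    by (simp add: frechet_derivative_def)
qed

lemma differentiable_cong_on:
  assumes "open U" "p \<in> U" "\<And>q. q \<in> U \<Longrightarrow> f q = g q"
  shows "f differentiable (at p) \<longleftrightarrow> g differentiable (at p)"
proof -
  have "(f has_derivative d) (at p) \<longleftrightarrow> (g has_derivative d) (at p)" for d
    by (rule has_derivative_cong_on[OF assms])
  then show ?thesis
    by (simp add: differentiable_def)
qed

lemma Ck_on_cong:
  assumes "open U" "\<And>q. q \<in> U \<Longrightarrow> f q = g q"
  shows "Ck_on k U f \<longleftrightarrow> Ck_on k U g"
  using assms(2)
proof (induction k arbitrary: f g)
  case 0
  then show ?case by (simp cong: continuous_on_cong)
next
  case (Suc k)
  have "frechet_derivative f (at q) v = frechet_derivative g (at q) v" if "q \<in> U" for q v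
    using frechet_derivative_cong_on[OF assms(1) that] Suc.prems by metis
  then have "Ck_on k U (\<lambda>p. frechet_derivative f (at p) v) \<longleftrightarrow>
      Ck_on k U (\<lambda>p. frechet_derivative g (at p) v)" for v
    by (intro Suc.IH) auto
  moreover have "f differentiable (at q) \<longleftrightarrow> g differentiable (at q)" if "q \<in> U" for q
    using differentiable_cong_on[OF assms(1) that] Suc.prems by metis
  ultimately show ?case by simp
qed

lemma smooth_on_cong:
  assumes "open U" "\<And>q. q \<in> U \<Longrightarrow> f q = g q"
  shows "smooth_on U f \<longleftrightarrow> smooth_on U g"
  unfolding smooth_on_def using Ck_on_cong[OF assms(1), of f g] assms(2) by blast

lemma Ck_on_SucD: "Ck_on (Suc k) U f \<Longrightarrow> Ck_on k U f"
proof (induction k arbitrary: f)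
  case 0
  then show ?case
    by (auto intro!: continuous_at_imp_continuous_on differentiable_imp_continuous_within)
next
  case (Suc k)
  have "Ck_on k U (\<lambda>p. frechet_derivative f (at p) v)" for v
    using Suc.prems by (intro Suc.IH) (auto simp only: Ck_on.simps(2))
  then show ?case
    using Suc.prems by auto
qed

lemma smooth_on_differentiable: "smooth_on U f \<Longrightarrow> p \<in> U \<Longrightarrow> f differentiable (at p)"
  by (auto simp: smooth_on_def dest: spec[of _ "Suc 0"])

lemma Ck_on_SucI:
  assumes "open U" "\<And>p. p \<in> U \<Longrightarrow> (f has_derivative f' p) (at p)"
    and "\<And>v. Ck_on k U (\<lambda>p. f' p v)"
  shows "Ck_on (Suc k) U f"
proof -
  have "frechet_derivative f (at p) = f' p" if "p \<in> U" for p
    using frechet_derivative_at[OF assms(2)[OF that]] by simp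
  then have "Ck_on k U (\<lambda>p. frechet_derivative f (at p) v)" for v
    using assms(3)[of v] Ck_on_cong[OF assms(1), of "\<lambda>p. frechet_derivative f (at p) v" "\<lambda>p. f' p v"]
    by auto
  then show ?thesis
    using assms(2) by (auto simp: differentiable_def)
qed

lemma Ck_on_const: "Ck_on k U (\<lambda>_. c)"
  by (induction k arbitrary: c) (auto simp: frechet_derivative_const)

lemma smooth_on_const: "smooth_on U (\<lambda>_. c)"
  by (simp add: smooth_on_def Ck_on_const)

lemma Ck_on_add:
  assumes "open U" "Ck_on k U f" "Ck_on k U g"
  shows "Ck_on k U (\<lambda>p. f p + g p)"
  using assms(2,3)
proof (induction k arbitrary: f g)
  case 0
  then show ?case by (simp add: continuous_on_add)
next
  case (Suc k)
  show ?case
  proof (rule Ck_on_SucI[OF assms(1)])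
    show "((\<lambda>p. f p + g p) has_derivative
        (\<lambda>v. frechet_derivative f (at p) v + frechet_derivative g (at p) v)) (at p)" if "p \<in> U" for p
      using Suc.prems that by (intro has_derivative_add has_derivative_frechet) simp_all
    show "Ck_on k U (\<lambda>p. frechet_derivative f (at p) v + frechet_derivative g (at p) v)" for v
      using Suc.prems by (intro Suc.IH) simp_all
  qed
qed

lemma Ck_on_bounded_linear:
  assumes "open U" "bounded_linear L" "Ck_on k U f"
  shows "Ck_on k U (\<lambda>p. L (f p))"
  using assms(3)
proof (induction k arbitrary: f)
  case 0
  then show ?case by (simp add: bounded_linear.continuous_on[OF assms(2)])
next
  case (Suc k)
  show ?case
  proof (rule Ck_on_SucI[OF assms(1)])
    show "((\<lambda>p. L (f p)) has_derivative (\<lambda>v. L (frechet_derivative f (at p) v))) (at p)" if "p \<in> U" for p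
      using Suc.prems that
      by (intro bounded_linear.has_derivative[OF assms(2)] has_derivative_frechet) simp_all
    show "Ck_on k U (\<lambda>p. L (frechet_derivative f (at p) v))" for v
      using Suc.prems by (intro Suc.IH) simp_all
  qed
qed

lemma Ck_on_bounded_bilinear:
  assumes "open U" "bounded_bilinear B" "Ck_on k U f" "Ck_on k U g"
  shows "Ck_on k U (\<lambda>p. B (f p) (g p))"
  using assms(3,4)
proof (induction k arbitrary: f g)
  case 0
  then show ?case by (simp add: bounded_bilinear.continuous_on[OF assms(2)])
next
  case (Suc k)
  show ?case
  proof (rule Ck_on_SucI[OF assms(1)])
    show "((\<lambda>p. B (f p) (g p)) has_derivative
        (\<lambda>v. B (f p) (frechet_derivative g (at p) v) + B (frechet_derivative f (at p) v) (g p))) (at p)"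
      if "p \<in> U" for p
      using Suc.prems that
      by (intro bounded_bilinear.FDERIV[OF assms(2)] has_derivative_frechet) simp_all
    show "Ck_on k U (\<lambda>p. B (f p) (frechet_derivative g (at p) v) + B (frechet_derivative f (at p) v) (g p))" for v
      using Suc.prems Ck_on_SucD[OF Suc.prems(1)] Ck_on_SucD[OF Suc.prems(2)]
      by (intro Ck_on_add[OF assms(1)] Suc.IH) simp_all
  qed
qed

text \<open>
  The derivative of \<open>1 / f\<close> contains \<open>1 / f\<close> itself, so the induction needs that \<open>1 / f\<close> is one degree
  less smooth, which its own hypothesis provides.
\<close>

lemma Ck_on_inverse:
  fixes f :: "'a::euclidean_space \<Rightarrow> real"
  assumes "open U" "Ck_on k U f" "\<And>p. p \<in> U \<Longrightarrow> f p \<noteq> 0"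
  shows "Ck_on k U (\<lambda>p. inverse (f p))"
  using assms(2)
proof (induction k)
  case 0
  then show ?case using assms(3) by (simp add: continuous_on_inverse)
next
  case (Suc k)
  show ?case
  proof (rule Ck_on_SucI[OF assms(1)])
    show "((\<lambda>p. inverse (f p)) has_derivative
        (\<lambda>v. - (inverse (f p) * frechet_derivative f (at p) v * inverse (f p)))) (at p)"
      if "p \<in> U" for p
      using Suc.prems that
      by (intro Deriv.has_derivative_inverse has_derivative_frechet assms(3)) simp_all
    have inv: "Ck_on k U (\<lambda>p. inverse (f p))"
      using Ck_on_SucD[OF Suc.prems] by (rule Suc.IH)
    have "Ck_on k U (\<lambda>p. frechet_derivative f (at p) v)" for v
      using Suc.prems by simp
    then have "Ck_on k U (\<lambda>p. inverse (f p) * frechet_derivative f (at p) v * inverse (f p))" for v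
      by (intro Ck_on_bounded_bilinear[OF assms(1) bounded_bilinear_mult] inv)
    then show "Ck_on k U (\<lambda>p. - (inverse (f p) * frechet_derivative f (at p) v * inverse (f p)))" for v
      by (rule Ck_on_bounded_linear[OF assms(1) bounded_linear_minus[OF bounded_linear_ident]])
  qed
qed

lemma Ck_on_compose_affine:
  assumes "open U" "open V" "bounded_linear A" "\<And>p. p \<in> V \<Longrightarrow> A p + c \<in> U" "Ck_on k U f"
  shows "Ck_on k V (\<lambda>p. f (A p + c))"
  using assms(5)
proof (induction k arbitrary: f)
  case 0
  have "continuous_on V (\<lambda>p. A p + c)"
    by (intro continuous_on_add continuous_on_const bounded_linear.continuous_on[OF assms(3)] continuous_on_id)
  then show ?case
    using 0 assms(4) continuous_on_compose2[of U f V "\<lambda>p. A p + c"] by auto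
next
  case (Suc k)
  show ?case
  proof (rule Ck_on_SucI[OF assms(2)])
    show "((\<lambda>p. f (A p + c)) has_derivative
        (\<lambda>v. frechet_derivative f (at (A p + c)) (A v))) (at p)" if "p \<in> V" for p
    proof -
      have "(f has_derivative frechet_derivative f (at (A p + c))) (at (A p + c))"
        using Suc.prems assms(4)[OF that] by (intro has_derivative_frechet) simp
      moreover have "((\<lambda>p. A p + c) has_derivative A) (at p)"
        by (intro has_derivative_add_const bounded_linear_imp_has_derivative assms(3))
      ultimately show ?thesis
        using has_derivative_compose by blast
    qed
    show "Ck_on k V (\<lambda>p. frechet_derivative f (at (A p + c)) (A v))" for v
      using Suc.prems Suc.IH[of "\<lambda>p. frechet_derivative f (at p) (A v)"] by simp
  qed
qed

lemma
  assumes "open U"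
  shows smooth_on_add: "smooth_on U f \<Longrightarrow> smooth_on U g \<Longrightarrow> smooth_on U (\<lambda>p. f p + g p)"
    and smooth_on_bounded_linear: "bounded_linear L \<Longrightarrow> smooth_on U f \<Longrightarrow> smooth_on U (\<lambda>p. L (f p))"
    and smooth_on_bounded_bilinear: "bounded_bilinear B \<Longrightarrow> smooth_on U f \<Longrightarrow> smooth_on U h \<Longrightarrow>
      smooth_on U (\<lambda>p. B (f p) (h p))"
    and smooth_on_inverse: "smooth_on U r \<Longrightarrow> (\<And>p. p \<in> U \<Longrightarrow> r p \<noteq> 0) \<Longrightarrow>
      smooth_on U (\<lambda>p. inverse (r p :: real))"
  by (simp_all add: smooth_on_def Ck_on_add[OF assms] Ck_on_bounded_linear[OF assms]
      Ck_on_bounded_bilinear[OF assms] Ck_on_inverse[OF assms])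

lemma smooth_on_ident:
  assumes "open U"
  shows "smooth_on U (\<lambda>p. p)"
proof -
  have "Ck_on k U (\<lambda>p. p)" for k
  proof (cases k)
    case (Suc j)
    show ?thesis
      unfolding Suc by (rule Ck_on_SucI[OF assms, of _ "\<lambda>p v. v"]) (simp_all add: Ck_on_const)
  qed simp
  then show ?thesis by (simp add: smooth_on_def)
qed

lemma smooth_on_compose_affine:
  assumes "open U" "open V" "bounded_linear A" "\<And>p. p \<in> V \<Longrightarrow> A p + c \<in> U" "smooth_on U f"
  shows "smooth_on V (\<lambda>p. f (A p + c))"
  using assms(5) Ck_on_compose_affine[OF assms(1-4)] unfolding smooth_on_def by blast

lemma smooth_on_sum:
  assumes "open U" "finite I" "\<And>i. i \<in> I \<Longrightarrow> smooth_on U (f i)"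
  shows "smooth_on U (\<lambda>p. \<Sum>i\<in>I. f i p)"
  using assms(2,3)
proof (induction I)
  case empty
  then show ?case by (simp add: smooth_on_const)
next
  case (insert i I)
  then show ?case by (simp add: smooth_on_add[OF assms(1)])
qed

lemma smooth_on_fst_snd:
  assumes "open U" "smooth_on U X"
  shows "smooth_on U (\<lambda>p. fst (X p))" "smooth_on U (\<lambda>p. snd (X p))"
  using smooth_on_bounded_linear[OF assms(1) bounded_linear_fst assms(2)]
    smooth_on_bounded_linear[OF assms(1) bounded_linear_snd assms(2)] by simp_all

lemma smooth_on_Pair:
  fixes f :: "'a::euclidean_space \<Rightarrow> 'b::real_normed_vector" and h :: "'a \<Rightarrow> 'c::real_normed_vector"
  assumes "open U" "smooth_on U f" "smooth_on U h"
  shows "smooth_on U (\<lambda>p. (f p, h p))"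
proof -
  have "bounded_linear (\<lambda>x::'b. (x, 0::'c))" "bounded_linear (\<lambda>y::'c. (0::'b, y))"
    by (intro bounded_linear_Pair bounded_linear_ident bounded_linear_zero)+
  from smooth_on_add[OF assms(1) smooth_on_bounded_linear[OF assms(1) this(1) assms(2)]
      smooth_on_bounded_linear[OF assms(1) this(2) assms(3)]]
  show ?thesis by simp
qed


section \<open>Christoffel symbols and curvature\<close>

definition christoffel :: "'a::euclidean_space conn \<Rightarrow> 'a \<Rightarrow> 'a \<Rightarrow> 'a \<Rightarrow> 'a" where
  "christoffel D p u v = D (\<lambda>_. u) (\<lambda>_. v) p"

text \<open>
  The coordinate expression of the curvature tensor for constant fields \<open>u\<close>, \<open>v\<close>, \<open>w\<close>, whose
  brackets vanish.
\<close>

definition christoffel_curvature :: "('a::euclidean_space \<Rightarrow> 'a \<Rightarrow> 'a \<Rightarrow> 'a) \<Rightarrow> 'a \<Rightarrow> 'a \<Rightarrow> 'a \<Rightarrow> 'a \<Rightarrow> 'a" where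
  "christoffel_curvature \<Gamma> p u v w =
     frechet_derivative (\<lambda>q. \<Gamma> q v w) (at p) u - frechet_derivative (\<lambda>q. \<Gamma> q u w) (at p) v +
     \<Gamma> p u (\<Gamma> p v w) - \<Gamma> p v (\<Gamma> p u w)"

lemma const_vector_field: "(\<lambda>_. u) \<in> vector_fields U"
  by (simp add: vector_fields_def smooth_on_const)

lemma vector_field_differentiable:
  "X \<in> vector_fields U \<Longrightarrow> p \<in> U \<Longrightarrow> X differentiable (at p)"
  by (simp add: vector_fields_def smooth_on_differentiable)

lemma dir_deriv_const: "dir_deriv X (\<lambda>_. c) p = 0"
  by (simp add: dir_deriv_def frechet_derivative_const)

lemma dir_deriv_eq:
  "(f has_derivative f') (at p) \<Longrightarrow> dir_deriv X f p = f' (X p)"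
  by (metis dir_deriv_def frechet_derivative_at)

lemma frechet_derivative_eq:
  "(f has_derivative f') (at p) \<Longrightarrow> frechet_derivative f (at p) = f'"
  by (metis frechet_derivative_at)

lemma affine_connectionD:
  assumes "affine_connection U D"
  shows affine_connection_closed: "X \<in> vector_fields U \<Longrightarrow> Y \<in> vector_fields U \<Longrightarrow> D X Y \<in> vector_fields U"
    and affine_connection_cong: "X \<in> vector_fields U \<Longrightarrow> X' \<in> vector_fields U \<Longrightarrow> Y \<in> vector_fields U \<Longrightarrow>
      Y' \<in> vector_fields U \<Longrightarrow> (\<And>p. p \<in> U \<Longrightarrow> X p = X' p \<and> Y p = Y' p) \<Longrightarrow> p \<in> U \<Longrightarrow> D X Y p = D X' Y' p"
    and affine_connection_add_left: "X \<in> vector_fields U \<Longrightarrow> X' \<in> vector_fields U \<Longrightarrow> Y \<in> vector_fields U \<Longrightarrow>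
      p \<in> U \<Longrightarrow> D (\<lambda>q. X q + X' q) Y p = D X Y p + D X' Y p"
    and affine_connection_scale_left: "X \<in> vector_fields U \<Longrightarrow> Y \<in> vector_fields U \<Longrightarrow> smooth_on U f \<Longrightarrow>
      p \<in> U \<Longrightarrow> D (\<lambda>q. f q *\<^sub>R X q) Y p = f p *\<^sub>R D X Y p"
    and affine_connection_add_right: "X \<in> vector_fields U \<Longrightarrow> Y \<in> vector_fields U \<Longrightarrow> Y' \<in> vector_fields U \<Longrightarrow>
      p \<in> U \<Longrightarrow> D X (\<lambda>q. Y q + Y' q) p = D X Y p + D X Y' p"
    and affine_connection_Leibniz: "X \<in> vector_fields U \<Longrightarrow> Y \<in> vector_fields U \<Longrightarrow> smooth_on U f \<Longrightarrow>
      p \<in> U \<Longrightarrow> D X (\<lambda>q. f q *\<^sub>R Y q) p = dir_deriv X f p *\<^sub>R Y p + f p *\<^sub>R D X Y p"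
proof -
  note c = assms[unfolded affine_connection_def]
  show "X \<in> vector_fields U \<Longrightarrow> Y \<in> vector_fields U \<Longrightarrow> D X Y \<in> vector_fields U"
    by (rule c[THEN conjunct1, rule_format])
  show "X \<in> vector_fields U \<Longrightarrow> X' \<in> vector_fields U \<Longrightarrow> Y \<in> vector_fields U \<Longrightarrow>
      Y' \<in> vector_fields U \<Longrightarrow> (\<And>p. p \<in> U \<Longrightarrow> X p = X' p \<and> Y p = Y' p) \<Longrightarrow> p \<in> U \<Longrightarrow> D X Y p = D X' Y' p"
    by (rule c[THEN conjunct2, THEN conjunct1, rule_format])
  show "X \<in> vector_fields U \<Longrightarrow> X' \<in> vector_fields U \<Longrightarrow> Y \<in> vector_fields U \<Longrightarrow>
      p \<in> U \<Longrightarrow> D (\<lambda>q. X q + X' q) Y p = D X Y p + D X' Y p"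
    by (rule c[THEN conjunct2, THEN conjunct2, THEN conjunct1, rule_format])
  show "X \<in> vector_fields U \<Longrightarrow> Y \<in> vector_fields U \<Longrightarrow> smooth_on U f \<Longrightarrow>
      p \<in> U \<Longrightarrow> D (\<lambda>q. f q *\<^sub>R X q) Y p = f p *\<^sub>R D X Y p"
    by (rule c[THEN conjunct2, THEN conjunct2, THEN conjunct2, THEN conjunct1, rule_format])
  show "X \<in> vector_fields U \<Longrightarrow> Y \<in> vector_fields U \<Longrightarrow> Y' \<in> vector_fields U \<Longrightarrow>
      p \<in> U \<Longrightarrow> D X (\<lambda>q. Y q + Y' q) p = D X Y p + D X Y' p"
    by (rule c[THEN conjunct2, THEN conjunct2, THEN conjunct2, THEN conjunct2, THEN conjunct1, rule_format])
  show "X \<in> vector_fields U \<Longrightarrow> Y \<in> vector_fields U \<Longrightarrow> smooth_on U f \<Longrightarrow>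
      p \<in> U \<Longrightarrow> D X (\<lambda>q. f q *\<^sub>R Y q) p = dir_deriv X f p *\<^sub>R Y p + f p *\<^sub>R D X Y p"
    by (rule c[THEN conjunct2, THEN conjunct2, THEN conjunct2, THEN conjunct2, THEN conjunct2, rule_format])
qed

lemma smooth_on_component:
  assumes "open U" "X \<in> vector_fields U"
  shows "smooth_on U (\<lambda>q. X q \<bullet> b)"
  using smooth_on_bounded_linear[OF assms(1) bounded_linear_inner_left] assms(2)
  by (simp add: vector_fields_def)

context
  fixes U :: "'a::euclidean_space set" and D :: "'a conn"
  assumes U: "open U" and D: "affine_connection U D"
begin

lemma affine_connection_sum_left:
  assumes "finite I" "\<And>i. i \<in> I \<Longrightarrow> X i \<in> vector_fields U" "Y \<in> vector_fields U" "p \<in> U"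
  shows "D (\<lambda>q. \<Sum>i\<in>I. X i q) Y p = (\<Sum>i\<in>I. D (X i) Y p)"
  using assms(1,2)
proof (induction I)
  case empty
  have "D (\<lambda>q. 0 *\<^sub>R (0::'a)) Y p = 0 *\<^sub>R D (\<lambda>_. 0) Y p"
    by (rule affine_connection_scale_left[OF D const_vector_field assms(3) smooth_on_const assms(4)])
  then show ?case by simp
next
  case (insert i I)
  have "(\<lambda>q. \<Sum>i\<in>I. X i q) \<in> vector_fields U"
    using insert by (simp add: vector_fields_def smooth_on_sum[OF U])
  then show ?case
    using insert assms(3,4) by (simp add: affine_connection_add_left[OF D])
qed

lemma affine_connection_sum_right:
  assumes "finite I" "\<And>i. i \<in> I \<Longrightarrow> Y i \<in> vector_fields U" "X \<in> vector_fields U" "p \<in> U"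
  shows "D X (\<lambda>q. \<Sum>i\<in>I. Y i q) p = (\<Sum>i\<in>I. D X (Y i) p)"
  using assms(1,2)
proof (induction I)
  case empty
  have "D X (\<lambda>q. 0 *\<^sub>R (0::'a)) p = dir_deriv X (\<lambda>_. 0 :: real) p *\<^sub>R 0 + 0 *\<^sub>R D X (\<lambda>_. 0) p"
    by (rule affine_connection_Leibniz[OF D assms(3) const_vector_field smooth_on_const assms(4)])
  then show ?case by simp
next
  case (insert i I)
  have "(\<lambda>q. \<Sum>i\<in>I. Y i q) \<in> vector_fields U"
    using insert by (simp add: vector_fields_def smooth_on_sum[OF U])
  then show ?case
    using insert assms(3,4) by (simp add: affine_connection_add_right[OF D])
qed

lemma affine_connection_expand_left:
  assumes "X \<in> vector_fields U" "Y \<in> vector_fields U" "p \<in> U"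
  shows "D X Y p = (\<Sum>b\<in>Basis. (X p \<bullet> b) *\<^sub>R D (\<lambda>_. b) Y p)"
proof -
  have *: "(\<lambda>q. (X q \<bullet> b) *\<^sub>R b) \<in> vector_fields U" for b
    using smooth_on_bounded_bilinear[OF U bounded_bilinear_scaleR smooth_on_component[OF U assms(1)] smooth_on_const]
    by (simp add: vector_fields_def)
  have "D X Y p = D (\<lambda>q. \<Sum>b\<in>Basis. (X q \<bullet> b) *\<^sub>R b) Y p"
    by (simp add: euclidean_representation)
  also have "\<dots> = (\<Sum>b\<in>Basis. D (\<lambda>q. (X q \<bullet> b) *\<^sub>R b) Y p)"
    using * assms by (intro affine_connection_sum_left) auto
  finally show ?thesis
    using affine_connection_scale_left[OF D const_vector_field assms(2) smooth_on_component[OF U assms(1)] assms(3)]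
    by simp
qed

text \<open>
  Both sides have the same expansion in the constant basis fields, because the coefficients are evaluated
  only at \<open>p\<close>.
\<close>

lemma affine_connection_tensorial_left:
  assumes "X \<in> vector_fields U" "Y \<in> vector_fields U" "p \<in> U"
  shows "D X Y p = D (\<lambda>_. X p) Y p"
  using affine_connection_expand_left[OF assms]
    affine_connection_expand_left[OF const_vector_field assms(2,3), of "X p"]
  by simp

lemma affine_connection_expand_right:
  assumes "X \<in> vector_fields U" "Y \<in> vector_fields U" "p \<in> U"
  shows "D X Y p = dir_deriv X Y p + (\<Sum>b\<in>Basis. (Y p \<bullet> b) *\<^sub>R D X (\<lambda>_. b) p)"
proof -
  have *: "(\<lambda>q. (Y q \<bullet> b) *\<^sub>R b) \<in> vector_fields U" for b
    using smooth_on_bounded_bilinear[OF U bounded_bilinear_scaleR smooth_on_component[OF U assms(2)] smooth_on_const]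
    by (simp add: vector_fields_def)
  have dd: "dir_deriv X (\<lambda>q. Y q \<bullet> b) p = dir_deriv X Y p \<bullet> b" for b
  proof -
    have "((\<lambda>q. Y q \<bullet> b) has_derivative (\<lambda>v. frechet_derivative Y (at p) v \<bullet> b)) (at p)"
      by (intro has_derivative_inner_left has_derivative_frechet vector_field_differentiable[OF assms(2,3)])
    from dir_deriv_eq[OF this] show ?thesis
      by (simp add: dir_deriv_def)
  qed
  have "D X Y p = D X (\<lambda>q. \<Sum>b\<in>Basis. (Y q \<bullet> b) *\<^sub>R b) p"
    by (simp add: euclidean_representation)
  also have "\<dots> = (\<Sum>b\<in>Basis. D X (\<lambda>q. (Y q \<bullet> b) *\<^sub>R b) p)"
    using * assms by (intro affine_connection_sum_right) auto
  also have "\<dots> = (\<Sum>b\<in>Basis. (dir_deriv X Y p \<bullet> b) *\<^sub>R b + (Y p \<bullet> b) *\<^sub>R D X (\<lambda>_. b) p)"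
    using affine_connection_Leibniz[OF D assms(1) const_vector_field smooth_on_component[OF U assms(2)] assms(3)]
    by (simp add: dd)
  finally show ?thesis
    by (simp add: sum.distrib euclidean_representation)
qed

text \<open>
  In the expansion of \<open>Y\<close> in the constant basis fields, the Leibniz rule differentiates the coefficients,
  which gives the flat derivative of \<open>Y\<close>; the remaining terms are tensorial in \<open>X\<close> and \<open>Y\<close>.
\<close>

lemma affine_connection_eq_christoffel:
  assumes "X \<in> vector_fields U" "Y \<in> vector_fields U" "p \<in> U"
  shows "D X Y p = dir_deriv X Y p + christoffel D p (X p) (Y p)"
proof -
  have "D X (\<lambda>_. Y p) p = (\<Sum>b\<in>Basis. (Y p \<bullet> b) *\<^sub>R D X (\<lambda>_. b) p)"
    using affine_connection_expand_right[OF assms(1) const_vector_field assms(3), of "Y p"]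
    by (simp add: dir_deriv_const)
  moreover have "D X (\<lambda>_. Y p) p = christoffel D p (X p) (Y p)"
    unfolding christoffel_def
    by (rule affine_connection_tensorial_left[OF assms(1) const_vector_field assms(3)])
  ultimately show ?thesis
    using affine_connection_expand_right[OF assms] by simp
qed

lemma bilinear_christoffel:
  assumes "p \<in> U"
  shows "bilinear (christoffel D p)"
proof -
  have "christoffel D p (u + u') v = christoffel D p u v + christoffel D p u' v" for u u' v
    unfolding christoffel_def
    by (rule affine_connection_add_left[OF D const_vector_field const_vector_field const_vector_field assms])
  moreover have "christoffel D p (r *\<^sub>R u) v = r *\<^sub>R christoffel D p u v" for r u v
    unfolding christoffel_def
    by (rule affine_connection_scale_left[OF D const_vector_field const_vector_field smooth_on_const assms])
  moreover have "christoffel D p u (v + v') = christoffel D p u v + christoffel D p u v'" for u v v'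
    unfolding christoffel_def
    by (rule affine_connection_add_right[OF D const_vector_field const_vector_field const_vector_field assms])
  moreover have "christoffel D p u (r *\<^sub>R v) = r *\<^sub>R christoffel D p u v" for r u v
    using affine_connection_Leibniz[OF D const_vector_field const_vector_field smooth_on_const[of U r] assms, of u v]
    unfolding christoffel_def by (simp add: dir_deriv_const)
  ultimately show ?thesis
    by (simp add: bilinear_def linear_iff)
qed

lemma christoffel_differentiable:
  "p \<in> U \<Longrightarrow> (\<lambda>q. christoffel D q u v) differentiable (at p)"
  using vector_field_differentiable[OF affine_connection_closed[OF D const_vector_field const_vector_field]]
  by (simp add: christoffel_def)

end

text \<open>
  Expanding in bases reduces this product rule to products of real functions, which is why differentiability of
  \<open>G q u v\<close> for fixed vectors suffices. It serves for Christoffel symbols and for metrics.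
\<close>

lemma has_derivative_bilinear_field:
  fixes G :: "'a::euclidean_space \<Rightarrow> 'b::euclidean_space \<Rightarrow> 'c::euclidean_space \<Rightarrow> 'd::real_normed_vector"
  assumes U: "open U" "p \<in> U" and bil: "\<And>q. q \<in> U \<Longrightarrow> bilinear (G q)"
    and G: "\<And>u v. (\<lambda>q. G q u v) differentiable (at p)"
    and Y: "(Y has_derivative Y') (at p)" and Z: "(Z has_derivative Z') (at p)"
  shows "((\<lambda>q. G q (Y q) (Z q)) has_derivative
    (\<lambda>w. frechet_derivative (\<lambda>q. G q (Y p) (Z p)) (at p) w + G p (Y' w) (Z p) + G p (Y p) (Z' w))) (at p)"
proof -
  define d where "d u v = frechet_derivative (\<lambda>q. G q u v) (at p)" for u v
  have d: "((\<lambda>q. G q u v) has_derivative d u v) (at p)" for u v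
    unfolding d_def using G by (rule has_derivative_frechet)
  have expand: "G q u v = (\<Sum>b\<in>Basis. \<Sum>c\<in>Basis. ((u \<bullet> b) * (v \<bullet> c)) *\<^sub>R G q b c)" if "q \<in> U" for q u v
  proof -
    have "G q (\<Sum>b\<in>Basis. (u \<bullet> b) *\<^sub>R b) (\<Sum>c\<in>Basis. (v \<bullet> c) *\<^sub>R c) =
        (\<Sum>(b, c)\<in>Basis \<times> Basis. G q ((u \<bullet> b) *\<^sub>R b) ((v \<bullet> c) *\<^sub>R c))"
      by (rule bilinear_sum[OF bil[OF that]])
    then show ?thesis
      using bil[OF that]
      by (simp add: euclidean_representation sum.cartesian_product bilinear_lmul bilinear_rmul
          case_prod_unfold mult.commute)
  qed
  have d_expand: "d u v w = (\<Sum>b\<in>Basis. \<Sum>c\<in>Basis. ((u \<bullet> b) * (v \<bullet> c)) *\<^sub>R d b c w)" for u v w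
  proof -
    have "((\<lambda>q. \<Sum>b\<in>Basis. \<Sum>c\<in>Basis. ((u \<bullet> b) * (v \<bullet> c)) *\<^sub>R G q b c) has_derivative
        (\<lambda>w. \<Sum>b\<in>Basis. \<Sum>c\<in>Basis. ((u \<bullet> b) * (v \<bullet> c)) *\<^sub>R d b c w)) (at p)"
      by (intro has_derivative_sum has_derivative_scaleR_right d)
    then have "((\<lambda>q. G q u v) has_derivative
        (\<lambda>w. \<Sum>b\<in>Basis. \<Sum>c\<in>Basis. ((u \<bullet> b) * (v \<bullet> c)) *\<^sub>R d b c w)) (at p)"
      by (subst has_derivative_cong_on[OF U expand])
    from fun_cong[OF has_derivative_unique[OF d this]] show ?thesis .
  qed
  have "((\<lambda>q. \<Sum>b\<in>Basis. \<Sum>c\<in>Basis. ((Y q \<bullet> b) * (Z q \<bullet> c)) *\<^sub>R G q b c) has_derivative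
      (\<lambda>w. \<Sum>b\<in>Basis. \<Sum>c\<in>Basis. ((Y p \<bullet> b) * (Z p \<bullet> c)) *\<^sub>R d b c w +
         ((Y p \<bullet> b) * (Z' w \<bullet> c) + (Y' w \<bullet> b) * (Z p \<bullet> c)) *\<^sub>R G p b c)) (at p)"
    by (intro has_derivative_sum has_derivative_scaleR d has_derivative_mult has_derivative_inner_left Y Z)
  then have "((\<lambda>q. G q (Y q) (Z q)) has_derivative
      (\<lambda>w. \<Sum>b\<in>Basis. \<Sum>c\<in>Basis. ((Y p \<bullet> b) * (Z p \<bullet> c)) *\<^sub>R d b c w +
         ((Y p \<bullet> b) * (Z' w \<bullet> c) + (Y' w \<bullet> b) * (Z p \<bullet> c)) *\<^sub>R G p b c)) (at p)"
    by (subst has_derivative_cong_on[OF U expand])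
  moreover have "(\<Sum>b\<in>Basis. \<Sum>c\<in>Basis. ((Y p \<bullet> b) * (Z p \<bullet> c)) *\<^sub>R d b c w +
         ((Y p \<bullet> b) * (Z' w \<bullet> c) + (Y' w \<bullet> b) * (Z p \<bullet> c)) *\<^sub>R G p b c) =
      d (Y p) (Z p) w + G p (Y' w) (Z p) + G p (Y p) (Z' w)" for w
    unfolding d_expand[of "Y p" "Z p"] expand[OF U(2), of "Y' w" "Z p"] expand[OF U(2), of "Y p" "Z' w"]
    by (simp add: sum.distrib scaleR_add_left add_ac)
  ultimately show ?thesis
    unfolding d_def by simp
qed

lemma christoffel_curvature_cong:
  assumes "open U" "p \<in> U" "\<And>q u v. q \<in> U \<Longrightarrow> \<Gamma> q u v = \<Gamma>' q u v"
  shows "christoffel_curvature \<Gamma> p u v w = christoffel_curvature \<Gamma>' p u v w"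
  unfolding christoffel_curvature_def
  using frechet_derivative_cong_on[OF assms(1,2), of "\<lambda>q. \<Gamma> q v w" "\<lambda>q. \<Gamma>' q v w"]
    frechet_derivative_cong_on[OF assms(1,2), of "\<lambda>q. \<Gamma> q u w" "\<lambda>q. \<Gamma>' q u w"] assms(2,3)
  by simp

text \<open>
  The terms with derivatives of \<open>X\<close>, \<open>Y\<close>, \<open>Z\<close> and Christoffel symbols cancel against the bracket term
  as in the usual proof that curvature is a tensor. The second derivatives of \<open>Z\<close> are
  collected in the curvature of the flat derivative, which is the same for all connections and so drops out
  whenever two curvatures are compared.
\<close>

lemma curvature_eq_christoffel:
  assumes U: "open U" and D: "affine_connection U D"
    and X: "X \<in> vector_fields U" and Y: "Y \<in> vector_fields U" and Z: "Z \<in> vector_fields U" and p: "p \<in> U"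
  shows "curvature D X Y Z p = curvature dir_deriv X Y Z p +
    christoffel_curvature (christoffel D) p (X p) (Y p) (Z p)"
proof -
  let ?G = "christoffel D"
  note eq = affine_connection_eq_christoffel[OF U D]
  note bil = bilinear_christoffel[OF U D p]
  have *: "D A (D B Z) p = dir_deriv A (dir_deriv B Z) p +
      frechet_derivative (\<lambda>q. ?G q (B p) (Z p)) (at p) (A p) + ?G p (dir_deriv A B p) (Z p) +
      ?G p (B p) (dir_deriv A Z p) + ?G p (A p) (dir_deriv B Z p) + ?G p (A p) (?G p (B p) (Z p))"
    if A: "A \<in> vector_fields U" and B: "B \<in> vector_fields U" for A B
  proof -
    define H where "H w = frechet_derivative (\<lambda>q. ?G q (B p) (Z p)) (at p) w +
      ?G p (frechet_derivative B (at p) w) (Z p) + ?G p (B p) (frechet_derivative Z (at p) w)" for w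
    have H: "((\<lambda>q. ?G q (B q) (Z q)) has_derivative H) (at p)"
      unfolding H_def
      by (intro has_derivative_bilinear_field[OF U p] bilinear_christoffel[OF U D]
          christoffel_differentiable[OF U D p] has_derivative_frechet vector_field_differentiable[OF _ p] B Z)
    have DBZ: "D B Z \<in> vector_fields U"
      by (rule affine_connection_closed[OF D B Z])
    have "((\<lambda>q. D B Z q - ?G q (B q) (Z q)) has_derivative
        (\<lambda>w. frechet_derivative (D B Z) (at p) w - H w)) (at p)"
      by (intro has_derivative_diff H has_derivative_frechet vector_field_differentiable[OF DBZ p])
    then have "(dir_deriv B Z has_derivative (\<lambda>w. frechet_derivative (D B Z) (at p) w - H w)) (at p)"
      by (subst has_derivative_cong_on[OF U p, where g = "\<lambda>q. D B Z q - ?G q (B q) (Z q)"])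
        (simp_all add: eq[OF B Z])
    then have "dir_deriv A (dir_deriv B Z) p = dir_deriv A (D B Z) p - H (A p)"
      by (simp add: dir_deriv_eq) (simp add: dir_deriv_def)
    moreover have "D A (D B Z) p = dir_deriv A (D B Z) p + ?G p (A p) (dir_deriv B Z p + ?G p (B p) (Z p))"
      using eq[OF A DBZ p] eq[OF B Z p] by simp
    ultimately show ?thesis
      by (simp add: H_def bilinear_radd[OF bil] dir_deriv_def)
  qed
  have bracket: "lie_bracket X Y \<in> vector_fields U"
  proof -
    have "smooth_on U (\<lambda>q. dir_deriv A B q)"
      if "A \<in> vector_fields U" "B \<in> vector_fields U" for A B
    proof -
      have "smooth_on U (\<lambda>q. \<Sum>b\<in>Basis. (A q \<bullet> b) *\<^sub>R frechet_derivative B (at q) b)"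
      proof (intro smooth_on_sum[OF U] smooth_on_bounded_bilinear[OF U bounded_bilinear_scaleR]
          smooth_on_component[OF U that(1)])
        show "smooth_on U (\<lambda>q. frechet_derivative B (at q) b)" for b
          using that(2) unfolding vector_fields_def smooth_on_def by (metis Ck_on.simps(2) mem_Collect_eq)
      qed simp
      moreover have "dir_deriv A B q = (\<Sum>b\<in>Basis. (A q \<bullet> b) *\<^sub>R frechet_derivative B (at q) b)"
        if "q \<in> U" for q
      proof -
        have lin: "linear (frechet_derivative B (at q))"
          using vector_field_differentiable[OF \<open>B \<in> vector_fields U\<close> that]
          by (rule linear_frechet_derivative)
        have "frechet_derivative B (at q) (\<Sum>b\<in>Basis. (A q \<bullet> b) *\<^sub>R b) =
            (\<Sum>b\<in>Basis. (A q \<bullet> b) *\<^sub>R frechet_derivative B (at q) b)"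
          by (simp only: linear_sum[OF lin] linear_cmul[OF lin])
        then show ?thesis
          by (simp only: dir_deriv_def euclidean_representation)
      qed
      ultimately show ?thesis
        using smooth_on_cong[OF U, of "dir_deriv A B"
            "\<lambda>q. \<Sum>b\<in>Basis. (A q \<bullet> b) *\<^sub>R frechet_derivative B (at q) b"] by simp
    qed
    from this[OF X Y] this[OF Y X] show ?thesis
      using smooth_on_add[OF U, of "dir_deriv X Y" "\<lambda>p. - dir_deriv Y X p"]
        smooth_on_bounded_linear[OF U bounded_linear_minus[OF bounded_linear_ident], of "dir_deriv Y X"]
      by (simp add: vector_fields_def lie_bracket_def[abs_def])
  qed
  show ?thesis
    unfolding curvature_def *[OF X Y] *[OF Y X] eq[OF bracket Z p] christoffel_curvature_def
    by (simp add: lie_bracket_def bilinear_lsub[OF bil] algebra_simps)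
qed

text \<open>
  The derivatives of \<open>Y\<close> and \<open>Z\<close> from the product rule cancel the flat parts of \<open>D X Y\<close> and
  \<open>D X Z\<close>.
\<close>

lemma cov_deriv_metric_tensorial:
  assumes U: "open U" and D: "affine_connection U D" and g: "riemannian_metric U g"
    and X: "X \<in> vector_fields U" and Y: "Y \<in> vector_fields U" and Z: "Z \<in> vector_fields U" and p: "p \<in> U"
  shows "cov_deriv_metric D g X Y Z p = frechet_derivative (\<lambda>q. g q (Y p) (Z p)) (at p) (X p) -
    g p (christoffel D p (X p) (Y p)) (Z p) - g p (Y p) (christoffel D p (X p) (Z p))"
proof -
  have bil: "bilinear (g q)" if "q \<in> U" for q
    using g that by (simp add: riemannian_metric_def)
  have diff: "(\<lambda>q. g q u v) differentiable (at p)" for u v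
    using g p by (intro smooth_on_differentiable[of U]) (simp_all add: riemannian_metric_def)
  have "((\<lambda>q. g q (Y q) (Z q)) has_derivative
    (\<lambda>w. frechet_derivative (\<lambda>q. g q (Y p) (Z p)) (at p) w + g p (frechet_derivative Y (at p) w) (Z p) +
      g p (Y p) (frechet_derivative Z (at p) w))) (at p)"
    by (intro has_derivative_bilinear_field[OF U p] bil diff
          has_derivative_frechet vector_field_differentiable[OF _ p] Y Z)
  from dir_deriv_eq[OF this, of X] show ?thesis
    unfolding cov_deriv_metric_def affine_connection_eq_christoffel[OF U D X Y p]
      affine_connection_eq_christoffel[OF U D X Z p]
    by (simp add: dir_deriv_def bilinear_ladd[OF bil[OF p]] bilinear_radd[OF bil[OF p]])
qed


section \<open>Gaussian moments\<close>

text \<open>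
  Lebesgue measure is the image of the product of the one-dimensional Lebesgue measures on the coordinates.
\<close>

lemma has_bochner_integral_lborel_prod:
  fixes f :: "'a::euclidean_space \<Rightarrow> real \<Rightarrow> real"
  assumes "\<And>b. b \<in> Basis \<Longrightarrow> has_bochner_integral lborel (f b) (I b)"
  shows "has_bochner_integral lborel (\<lambda>x::'a. \<Prod>b\<in>Basis. f b (x \<bullet> b)) (\<Prod>b\<in>Basis. I b)"
proof -
  interpret product_sigma_finite "\<lambda>_::'a. lborel :: real measure" ..
  have int: "integrable lborel (f b)" if "b \<in> Basis" for b
    using assms[OF that] by (simp add: has_bochner_integral_iff)
  have [measurable]: "f b \<in> borel_measurable borel" if "b \<in> Basis" for b
    using borel_measurable_integrable[OF int[OF that]] by simp
  have L: "(lborel :: 'a measure) = distr (\<Pi>\<^sub>M b\<in>Basis. lborel) borel (\<lambda>y. \<Sum>b\<in>Basis. y b *\<^sub>R b)"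
    by (rule lborel_eq)
  let ?T = "\<lambda>y::'a \<Rightarrow> real. \<Sum>b\<in>Basis. y b *\<^sub>R b"
  have comp: "(\<lambda>y. \<Prod>b\<in>Basis. f b (?T y \<bullet> b)) = (\<lambda>y. \<Prod>b\<in>Basis. f b (y b))"
    by (intro ext prod.cong) (simp_all add: inner_sum_left_Basis)
  have "integrable lborel (\<lambda>x::'a. \<Prod>b\<in>Basis. f b (x \<bullet> b))"
    unfolding L by (subst integrable_distr_eq) (simp_all add: comp product_integrable_prod int)
  moreover have "integral\<^sup>L (lborel :: 'a measure) (\<lambda>x. \<Prod>b\<in>Basis. f b (x \<bullet> b)) = (\<Prod>b\<in>Basis. I b)"
    unfolding L
    by (subst integral_distr)
      (simp_all add: comp product_integral_prod int has_bochner_integral_integral_eq[OF assms])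
  ultimately show ?thesis
    by (simp add: has_bochner_integral_iff)
qed

definition normal_central_moment :: "real \<Rightarrow> nat \<Rightarrow> real" where
  "normal_central_moment \<sigma> k =
     (if even k then fact k / ((2 / \<sigma>\<^sup>2) ^ (k div 2) * fact (k div 2)) else 0)"

text \<open>
  The expectation of \<open>p(X)\<close> for a centred normal variable \<open>X\<close> with standard deviation \<open>\<sigma>\<close>. It is defined
  through the moments, which makes it computable from the coefficients of \<open>p\<close>; polynomials serve as
  integrands because all of their products are integrable against the normal density.
\<close>

definition gauss_mean :: "real \<Rightarrow> real poly \<Rightarrow> real" where
  "gauss_mean \<sigma> p = (\<Sum>i\<le>degree p. coeff p i * normal_central_moment \<sigma> i)"

lemma gauss_mean_eq_sum:
  assumes "degree p \<le> N"
  shows "gauss_mean \<sigma> p = (\<Sum>i\<le>N. coeff p i * normal_central_moment \<sigma> i)"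
  unfolding gauss_mean_def using assms
  by (intro sum.mono_neutral_left) (auto simp: coeff_eq_0)

lemma has_bochner_integral_gauss_mean:
  assumes "\<sigma> > 0"
  shows "has_bochner_integral lborel (\<lambda>t. normal_density \<mu> \<sigma> t * poly p (t - \<mu>)) (gauss_mean \<sigma> p)"
proof -
  have moment: "has_bochner_integral lborel (\<lambda>t. normal_density \<mu> \<sigma> t * (t - \<mu>) ^ k) (normal_central_moment \<sigma> k)" for k
  proof (cases "even k")
    case True
    then show ?thesis
      using normal_moment_even[OF assms, of \<mu> "k div 2"] by (simp add: normal_central_moment_def)
  next
    case False
    then show ?thesis
      using normal_moment_odd[OF assms, of \<mu> "k div 2"] by (simp add: normal_central_moment_def)
  qed
  have "has_bochner_integral lborel
      (\<lambda>t. \<Sum>i\<le>degree p. coeff p i * (normal_density \<mu> \<sigma> t * (t - \<mu>) ^ i)) (gauss_mean \<sigma> p)"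
    unfolding gauss_mean_def by (intro has_bochner_integral_sum has_bochner_integral_mult_right moment)
  then show ?thesis
    by (simp add: poly_altdef sum_distrib_left mult_ac)
qed

lemma gauss_mean_1: "gauss_mean \<sigma> 1 = 1"
  by (simp add: gauss_mean_def normal_central_moment_def)

lemma gauss_mean_sextic:
  assumes "\<sigma> > 0"
  shows "gauss_mean \<sigma> [:c0, c1, c2, c3, c4, c5, c6:] = c0 + c2 * \<sigma>\<^sup>2 + 3 * c4 * \<sigma> ^ 4 + 15 * c6 * \<sigma> ^ 6"
proof -
  have "degree [:c0, c1, c2, c3, c4, c5, c6:] \<le> 6"
    by (simp add: degree_pCons_eq_if)
  moreover have "(\<Sum>i\<le>6. f i) = f 0 + f 1 + f 2 + f 3 + f 4 + f 5 + f 6" for f :: "nat \<Rightarrow> real"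
    by (simp add: eval_nat_numeral)
  moreover have "coeff [:c0, c1, c2, c3, c4, c5, c6:] 2 = c2" "coeff [:c0, c1, c2, c3, c4, c5, c6:] 4 = c4"
      "coeff [:c0, c1, c2, c3, c4, c5, c6:] 6 = c6"
    by (simp_all add: eval_nat_numeral)
  moreover have "normal_central_moment \<sigma> 0 = 1" "normal_central_moment \<sigma> 1 = 0"
      "normal_central_moment \<sigma> 2 = \<sigma>\<^sup>2" "normal_central_moment \<sigma> 3 = 0"
      "normal_central_moment \<sigma> 4 = 3 * \<sigma> ^ 4" "normal_central_moment \<sigma> 5 = 0"
      "normal_central_moment \<sigma> 6 = 15 * \<sigma> ^ 6"
    using assms
    by (simp_all add: normal_central_moment_def fact_numeral power_divide flip: power_mult)
  ultimately show ?thesis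
    by (simp add: gauss_mean_eq_sum)
qed

abbreviation gauss_product :: "real \<Rightarrow> 'a::euclidean_space \<Rightarrow> 'a \<Rightarrow> real" where
  "gauss_product \<sigma> \<mu> x \<equiv> \<Prod>b\<in>Basis. normal_density (\<mu> \<bullet> b) \<sigma> (x \<bullet> b)"

abbreviation separable :: "'a::euclidean_space \<Rightarrow> ('a \<Rightarrow> real poly) \<Rightarrow> 'a \<Rightarrow> real" where
  "separable \<mu> q x \<equiv> \<Sum>b\<in>Basis. poly (q b) (x \<bullet> b - \<mu> \<bullet> b)"

lemma has_bochner_integral_gauss_product:
  fixes P :: "'a::euclidean_space \<Rightarrow> real poly"
  assumes "\<sigma> > 0"
  shows "has_bochner_integral lborel
    (\<lambda>x. (\<Prod>b\<in>Basis. poly (P b) (x \<bullet> b - \<mu> \<bullet> b)) * gauss_product \<sigma> \<mu> x)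
    (\<Prod>b\<in>Basis. gauss_mean \<sigma> (P b))"
proof -
  have "has_bochner_integral lborel
      (\<lambda>x::'a. \<Prod>b\<in>Basis. normal_density (\<mu> \<bullet> b) \<sigma> (x \<bullet> b) * poly (P b) (x \<bullet> b - \<mu> \<bullet> b))
      (\<Prod>b\<in>Basis. gauss_mean \<sigma> (P b))"
    by (rule has_bochner_integral_lborel_prod) (rule has_bochner_integral_gauss_mean[OF assms])
  then show ?thesis
    by (simp add: prod.distrib mult.commute)
qed

text \<open>
  Covariances of sums of independent centred variables add up: expanding the product of the sums, a term with
  two different coordinates contains a factor of mean zero.
\<close>

lemma gauss_second_cumulant:
  fixes q r :: "'a::euclidean_space \<Rightarrow> real poly"
  assumes \<sigma>: "\<sigma> > 0"
    and mean: "\<And>b. b \<in> Basis \<Longrightarrow> gauss_mean \<sigma> (q b) = 0" "\<And>b. b \<in> Basis \<Longrightarrow> gauss_mean \<sigma> (r b) = 0"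
  shows "(LINT x|lborel. separable \<mu> q x * separable \<mu> r x * gauss_product \<sigma> \<mu> x) =
    (\<Sum>b\<in>Basis. gauss_mean \<sigma> (q b * r b))"
proof -
  define P where "P i j b = (if b = i then q b else 1) * (if b = j then r b else 1)" for i j b
  have integrand: "separable \<mu> q x * separable \<mu> r x * gauss_product \<sigma> \<mu> x =
      (\<Sum>i\<in>Basis. \<Sum>j\<in>Basis. (\<Prod>b\<in>Basis. poly (P i j b) (x \<bullet> b - \<mu> \<bullet> b)) * gauss_product \<sigma> \<mu> x)" for x
    by (simp add: P_def prod.distrib if_distrib[of "\<lambda>p. poly p _"] prod.delta'
        cong: if_cong flip: sum_distrib_left sum_distrib_right)
  have mean_P: "(\<Prod>b\<in>Basis. gauss_mean \<sigma> (P i j b)) = (if i = j then gauss_mean \<sigma> (q i * r i) else 0)"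
    if "i \<in> Basis" "j \<in> Basis" for i j
  proof (cases "i = j")
    case True
    then have "gauss_mean \<sigma> (P i j b) = (if b = i then gauss_mean \<sigma> (q i * r i) else 1)" for b
      by (simp add: P_def gauss_mean_1)
    then show ?thesis using True that by simp
  next
    case False
    then have "gauss_mean \<sigma> (P i j i) = 0"
      using that by (simp add: P_def mean)
    then show ?thesis using False that(1) by (auto simp: prod_zero_iff)
  qed
  have "(LINT x|lborel. separable \<mu> q x * separable \<mu> r x * gauss_product \<sigma> \<mu> x) =
      (\<Sum>i\<in>Basis. \<Sum>j\<in>Basis. \<Prod>b\<in>Basis. gauss_mean \<sigma> (P i j b))"
    unfolding integrand
    by (intro has_bochner_integral_integral_eq has_bochner_integral_sum has_bochner_integral_gauss_product \<sigma>)
  then show ?thesis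
    by (simp add: mean_P)
qed

text \<open>
  As for covariances: of three indices that are not all equal, one differs from the other two, and its
  factor has mean zero. For fourth moments this would fail, since indices can then coincide in pairs.
\<close>

lemma gauss_third_cumulant:
  fixes q r s :: "'a::euclidean_space \<Rightarrow> real poly"
  assumes \<sigma>: "\<sigma> > 0"
    and mean: "\<And>b. b \<in> Basis \<Longrightarrow> gauss_mean \<sigma> (q b) = 0" "\<And>b. b \<in> Basis \<Longrightarrow> gauss_mean \<sigma> (r b) = 0"
      "\<And>b. b \<in> Basis \<Longrightarrow> gauss_mean \<sigma> (s b) = 0"
  shows "(LINT x|lborel. separable \<mu> q x * separable \<mu> r x * separable \<mu> s x * gauss_product \<sigma> \<mu> x) =
    (\<Sum>b\<in>Basis. gauss_mean \<sigma> (q b * r b * s b))"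
proof -
  define P where "P i j k b = (if b = i then q b else 1) * (if b = j then r b else 1) * (if b = k then s b else 1)"
    for i j k b
  have integrand: "separable \<mu> q x * separable \<mu> r x * separable \<mu> s x * gauss_product \<sigma> \<mu> x =
      (\<Sum>i\<in>Basis. \<Sum>j\<in>Basis. \<Sum>k\<in>Basis.
        (\<Prod>b\<in>Basis. poly (P i j k b) (x \<bullet> b - \<mu> \<bullet> b)) * gauss_product \<sigma> \<mu> x)" for x
    by (simp add: P_def prod.distrib if_distrib[of "\<lambda>p. poly p _"] prod.delta'
        cong: if_cong flip: sum_distrib_left sum_distrib_right)
  have mean_P: "(\<Prod>b\<in>Basis. gauss_mean \<sigma> (P i j k b)) =
      (if k = j then if j = i then gauss_mean \<sigma> (q i * r i * s i) else 0 else 0)"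
    if ijk: "i \<in> Basis" "j \<in> Basis" "k \<in> Basis" for i j k
  proof (cases "i = j \<and> j = k")
    case True
    then have "gauss_mean \<sigma> (P i j k b) = (if b = i then gauss_mean \<sigma> (q i * r i * s i) else 1)" for b
      by (simp add: P_def gauss_mean_1)
    then show ?thesis using True ijk by simp
  next
    case False
    then consider "i \<noteq> j" "i \<noteq> k" | "j \<noteq> i" "j \<noteq> k" | "k \<noteq> i" "k \<noteq> j" by metis
    then have "\<exists>b\<in>Basis. gauss_mean \<sigma> (P i j k b) = 0"
    proof cases
      case 1
      then show ?thesis using ijk by (intro bexI[of _ i]) (simp_all add: P_def mean)
    next
      case 2
      then show ?thesis using ijk by (intro bexI[of _ j]) (simp_all add: P_def mean)
    next
      case 3
      then show ?thesis using ijk by (intro bexI[of _ k]) (simp_all add: P_def mean)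
    qed
    then show ?thesis using False by (auto simp: prod_zero_iff)
  qed
  have "(LINT x|lborel. separable \<mu> q x * separable \<mu> r x * separable \<mu> s x * gauss_product \<sigma> \<mu> x) =
      (\<Sum>i\<in>Basis. \<Sum>j\<in>Basis. \<Sum>k\<in>Basis. \<Prod>b\<in>Basis. gauss_mean \<sigma> (P i j k b))"
    unfolding integrand
    by (intro has_bochner_integral_integral_eq has_bochner_integral_sum has_bochner_integral_gauss_product \<sigma>)
  then show ?thesis
    by (simp add: mean_P)
qed


section \<open>The Fisher metric and the Amari--Chentsov tensor\<close>

text \<open>
  The contribution of one coordinate to the score, in the centred variable. The constant term is minus the
  leading coefficient times the variance, in the form of a square to match the general quadratic polynomial of
  mean zero.
\<close>

definition score_poly :: "real \<times> (real ^ 'n) \<Rightarrow> real \<times> (real ^ 'n) \<Rightarrow> real ^ 'n \<Rightarrow> real poly" where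
  "score_poly \<theta> u b = 
    [:- (fst u / (2 * (fst \<theta>)\<^sup>2)) * (sqrt (fst \<theta>))\<^sup>2, (snd u \<bullet> b) / fst \<theta>, fst u / (2 * (fst \<theta>)\<^sup>2):]"

lemma gauss_density_eq_product:
  fixes \<theta> :: "real \<times> (real ^ 'n)"
  assumes "\<theta> \<in> takano_space"
  shows "gauss_density \<theta> x = gauss_product (sqrt (fst \<theta>)) (snd \<theta>) x"
proof -
  have S: "fst \<theta> > 0" using assms by (auto simp: takano_space_def)
  have "(2 * pi * fst \<theta>) powr (- real CARD('n) / 2) = (1 / sqrt (2 * pi * fst \<theta>)) ^ CARD('n)"
  proof -
    have "sqrt (2 * pi * fst \<theta>) ^ CARD('n) = (2 * pi * fst \<theta>) powr (real CARD('n) / 2)"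
      using S by (simp add: powr_half_sqrt [symmetric] powr_powr flip: powr_realpow)
    then show ?thesis
      by (simp add: powr_minus_divide power_one_over)
  qed
  moreover have "exp (- (norm (x - snd \<theta>))\<^sup>2 / (2 * fst \<theta>)) =
      (\<Prod>b\<in>Basis. exp (- (x \<bullet> b - snd \<theta> \<bullet> b)\<^sup>2 / (2 * fst \<theta>)))"
    unfolding power2_norm_eq_inner euclidean_inner[of "x - snd \<theta>" "x - snd \<theta>"]
    by (simp add: inner_diff_left power2_eq_square sum_divide_distrib sum_negf flip: exp_sum)
  ultimately show ?thesis
    using S by (simp add: gauss_density_def normal_density_def prod_dividef power_one_over)
qed

lemma score_eq_separable:
  fixes \<theta> u :: "real \<times> (real ^ 'n)"
  assumes "\<theta> \<in> takano_space"
  shows "score \<theta> u x = separable (snd \<theta>) (score_poly \<theta> u) x"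
proof -
  have S: "fst \<theta> > 0" using assms by (auto simp: takano_space_def)
  define L where "L \<theta>' = - real CARD('n) / 2 * ln (2 * pi * fst \<theta>') - ((x - snd \<theta>') \<bullet> (x - snd \<theta>')) / (2 * fst \<theta>')"
    for \<theta>' :: "real \<times> (real ^ 'n)"
  have "open (takano_space :: (real \<times> (real ^ 'n)) set)"
    unfolding takano_space_def by (intro open_Times) auto
  moreover have "ln (gauss_density \<theta>' x) = L \<theta>'" if "\<theta>' \<in> takano_space" for \<theta>'
  proof -
    have "fst \<theta>' > 0" using that by (auto simp: takano_space_def)
    then show ?thesis
      by (simp add: gauss_density_def L_def ln_mult ln_powr power2_norm_eq_inner)
  qed
  moreover have "(L has_derivative (\<lambda>u. - real CARD('n) / 2 * (fst u / fst \<theta>) +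
      (snd u \<bullet> (x - snd \<theta>)) / fst \<theta> + ((x - snd \<theta>) \<bullet> (x - snd \<theta>)) * fst u / (2 * (fst \<theta>)\<^sup>2))) (at \<theta>)"
    unfolding L_def using S
    by (auto intro!: derivative_eq_intros simp: field_simps power2_eq_square inner_commute)
  ultimately have "((\<lambda>\<theta>'. ln (gauss_density \<theta>' x)) has_derivative (\<lambda>u. - real CARD('n) / 2 * (fst u / fst \<theta>) +
      (snd u \<bullet> (x - snd \<theta>)) / fst \<theta> + ((x - snd \<theta>) \<bullet> (x - snd \<theta>)) * fst u / (2 * (fst \<theta>)\<^sup>2))) (at \<theta>)"
    using assms has_derivative_transform_within_open[of L _ \<theta> UNIV takano_space] by simp
  from frechet_derivative_at[OF this]
  have score: "score \<theta> u x = - real CARD('n) / 2 * (fst u / fst \<theta>) +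
      (snd u \<bullet> (x - snd \<theta>)) / fst \<theta> + ((x - snd \<theta>) \<bullet> (x - snd \<theta>)) * fst u / (2 * (fst \<theta>)\<^sup>2)"
    unfolding score_def by (metis (no_types, lifting))
  let ?s = "fst u" and ?m = "snd u" and ?y = "x - snd \<theta>"
  have "separable (snd \<theta>) (score_poly \<theta> u) x =
      (\<Sum>b\<in>Basis. - ?s / (2 * fst \<theta>) + (?m \<bullet> b) * (?y \<bullet> b) / fst \<theta> +
        ?s / (2 * (fst \<theta>)\<^sup>2) * ((?y \<bullet> b) * (?y \<bullet> b)))"
    using S by (intro sum.cong refl) (simp add: score_poly_def inner_diff_left field_simps power2_eq_square)
  also have "\<dots> = real CARD('n) * (- ?s / (2 * fst \<theta>)) + (\<Sum>b\<in>Basis. (?m \<bullet> b) * (?y \<bullet> b)) / fst \<theta> +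
        ?s / (2 * (fst \<theta>)\<^sup>2) * (\<Sum>b\<in>Basis. (?y \<bullet> b) * (?y \<bullet> b))"
    by (simp add: sum.distrib sum_subtractf flip: sum_divide_distrib sum_distrib_left)
  also have "\<dots> = score \<theta> u x"
    unfolding score euclidean_inner[of ?m ?y] euclidean_inner[of ?y ?y] by simp
  finally show ?thesis ..
qed

text \<open>
  By additivity of cumulants these are the shares of one coordinate in the mean, the covariance and the third
  cumulant of scores.
\<close>

lemma gauss_mean_centred_quadratics:
  assumes "\<sigma> > 0"
  shows gauss_mean_quadratic: "gauss_mean \<sigma> [:- a * \<sigma>\<^sup>2, b, a:] = 0"
    and gauss_mean_quadratic2: "gauss_mean \<sigma> ([:- a * \<sigma>\<^sup>2, b, a:] * [:- a' * \<sigma>\<^sup>2, b', a':]) =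
      2 * a * a' * \<sigma> ^ 4 + b * b' * \<sigma>\<^sup>2"
    and gauss_mean_quadratic3: "gauss_mean \<sigma> ([:- a * \<sigma>\<^sup>2, b, a:] * [:- a' * \<sigma>\<^sup>2, b', a':] *
      [:- a'' * \<sigma>\<^sup>2, b'', a'':]) =
      8 * a * a' * a'' * \<sigma> ^ 6 + 2 * (a * b' * b'' + a' * b * b'' + a'' * b * b') * \<sigma> ^ 4"
proof -
  note sextic = gauss_mean_sextic[OF assms]
  show "gauss_mean \<sigma> [:- a * \<sigma>\<^sup>2, b, a:] = 0"
    using sextic[of _ _ _ 0 0 0 0] by simp
  show "gauss_mean \<sigma> ([:- a * \<sigma>\<^sup>2, b, a:] * [:- a' * \<sigma>\<^sup>2, b', a':]) = 2 * a * a' * \<sigma> ^ 4 + b * b' * \<sigma>\<^sup>2"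
    using sextic[of _ _ _ _ _ 0 0] by (simp add: algebra_simps eval_nat_numeral)
  show "gauss_mean \<sigma> ([:- a * \<sigma>\<^sup>2, b, a:] * [:- a' * \<sigma>\<^sup>2, b', a':] * [:- a'' * \<sigma>\<^sup>2, b'', a'':]) =
      8 * a * a' * a'' * \<sigma> ^ 6 + 2 * (a * b' * b'' + a' * b * b'' + a'' * b * b') * \<sigma> ^ 4"
    by (simp add: sextic) (simp add: algebra_simps eval_nat_numeral)
qed

lemma gauss_mean_score_poly:
  assumes "\<theta> \<in> takano_space"
  shows "gauss_mean (sqrt (fst \<theta>)) (score_poly \<theta> u b) = 0"
  unfolding score_poly_def using assms by (intro gauss_mean_quadratic) (auto simp: takano_space_def)

lemma fisher_metric_eq:
  fixes \<theta> u v :: "real \<times> (real ^ 'n)"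
  assumes "\<theta> \<in> takano_space"
  shows "fisher_metric \<theta> u v = real CARD('n) * fst u * fst v / (2 * (fst \<theta>)\<^sup>2) + (snd u \<bullet> snd v) / fst \<theta>"
proof -
  have S: "fst \<theta> > 0" using assms by (auto simp: takano_space_def)
  have "gauss_mean (sqrt (fst \<theta>)) (score_poly \<theta> u b * score_poly \<theta> v b) =
      fst u * fst v / (2 * (fst \<theta>)\<^sup>2) + (snd u \<bullet> b) * (snd v \<bullet> b) / fst \<theta>" for b
  proof -
    have "sqrt (fst \<theta>) ^ 4 = (fst \<theta>)\<^sup>2"
      using S power_mult[of "sqrt (fst \<theta>)" 2 2] by simp
    then show ?thesis
      unfolding score_poly_def gauss_mean_quadratic2[OF real_sqrt_gt_zero[OF S]]
      using S by (simp add: field_simps power2_eq_square)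
  qed
  then have "fisher_metric \<theta> u v =
      (\<Sum>b\<in>Basis. fst u * fst v / (2 * (fst \<theta>)\<^sup>2) + (snd u \<bullet> b) * (snd v \<bullet> b) / fst \<theta>)"
    unfolding fisher_metric_def score_eq_separable[OF assms] gauss_density_eq_product[OF assms]
    using S by (subst gauss_second_cumulant) (simp_all add: gauss_mean_score_poly[OF assms])
  then show ?thesis
    by (simp add: sum.distrib euclidean_inner[of "snd u" "snd v"] sum_divide_distrib)
qed

lemma amari_chentsov_tensor_eq:
  fixes \<theta> u v w :: "real \<times> (real ^ 'n)"
  assumes "\<theta> \<in> takano_space"
  shows "amari_chentsov_tensor \<alpha> \<theta> u v w = \<alpha> * (real CARD('n) * fst u * fst v * fst w / (fst \<theta>) ^ 3 +
    (fst u * (snd v \<bullet> snd w) + fst v * (snd u \<bullet> snd w) + fst w * (snd u \<bullet> snd v)) / (fst \<theta>)\<^sup>2)"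
proof -
  have S: "fst \<theta> > 0" using assms by (auto simp: takano_space_def)
  have "gauss_mean (sqrt (fst \<theta>)) (score_poly \<theta> u b * score_poly \<theta> v b * score_poly \<theta> w b) =
      fst u * fst v * fst w / (fst \<theta>) ^ 3 + (fst u * ((snd v \<bullet> b) * (snd w \<bullet> b)) +
      fst v * ((snd u \<bullet> b) * (snd w \<bullet> b)) + fst w * ((snd u \<bullet> b) * (snd v \<bullet> b))) / (fst \<theta>)\<^sup>2" for b
  proof -
    have "sqrt (fst \<theta>) ^ 4 = (fst \<theta>)\<^sup>2" "sqrt (fst \<theta>) ^ 6 = (fst \<theta>) ^ 3"
      using S power_mult[of "sqrt (fst \<theta>)" 2 2] power_mult[of "sqrt (fst \<theta>)" 2 3] by simp_all
    then show ?thesis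
      unfolding score_poly_def gauss_mean_quadratic3[OF real_sqrt_gt_zero[OF S]]
      using S by (simp add: field_simps power2_eq_square power3_eq_cube)
  qed
  then have "amari_chentsov_tensor \<alpha> \<theta> u v w = \<alpha> *
      (\<Sum>b\<in>Basis. fst u * fst v * fst w / (fst \<theta>) ^ 3 + (fst u * ((snd v \<bullet> b) * (snd w \<bullet> b)) +
      fst v * ((snd u \<bullet> b) * (snd w \<bullet> b)) + fst w * ((snd u \<bullet> b) * (snd v \<bullet> b))) / (fst \<theta>)\<^sup>2)"
    unfolding amari_chentsov_tensor_def score_eq_separable[OF assms] gauss_density_eq_product[OF assms]
    using S by (subst gauss_third_cumulant) (simp_all add: gauss_mean_score_poly[OF assms])
  then show ?thesis
    unfolding euclidean_inner[of "snd u" "snd v"] euclidean_inner[of "snd u" "snd w"]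
      euclidean_inner[of "snd v" "snd w"]
    by (simp add: sum.distrib flip: sum_divide_distrib sum_distrib_left)
qed


section \<open>The Amari--Chentsov connections\<close>

lemma open_takano_space: "open takano_space"
  unfolding takano_space_def by (intro open_Times) auto

text \<open>
  Solving \<open>2 g(\<Gamma>(u, v), w) = \<partial>\<^sub>u g(v, w) + \<partial>\<^sub>v g(u, w) - \<partial>\<^sub>w g(u, v) - C(u, v, w)\<close> for \<open>\<Gamma>\<close>, with \<open>C\<close> the
  Amari--Chentsov tensor, gives this formula.
\<close>

definition alpha_christoffel ::
    "real \<Rightarrow> real \<times> (real ^ 'n) \<Rightarrow> real \<times> (real ^ 'n) \<Rightarrow> real \<times> (real ^ 'n) \<Rightarrow> real \<times> (real ^ 'n)" where
  "alpha_christoffel \<alpha> p u v =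
     (- (1 + \<alpha>) * fst u * fst v / fst p + (1 - \<alpha>) * (snd u \<bullet> snd v) / real CARD('n),
      (- (1 + \<alpha>) / (2 * fst p)) *\<^sub>R (fst u *\<^sub>R snd v + fst v *\<^sub>R snd u))"

lemma alpha_christoffel_commute: "alpha_christoffel \<alpha> p u v = alpha_christoffel \<alpha> p v u"
  by (simp add: alpha_christoffel_def inner_commute add.commute mult_ac)

lemma bilinear_alpha_christoffel: "bilinear (alpha_christoffel \<alpha> p)"
  by (simp add: bilinear_def linear_iff alpha_christoffel_def prod_eq_iff vec_eq_iff inner_add_left
      inner_add_right algebra_simps)
    (simp add: add_divide_distrib diff_divide_distrib)

lemma alpha_christoffel_has_derivative:
  fixes p :: "real \<times> (real ^ 'n)"
  assumes "p \<in> takano_space"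
  shows "((\<lambda>q. alpha_christoffel \<alpha> q u v) has_derivative
    (\<lambda>w. (fst w / (fst p)\<^sup>2) *\<^sub>R ((1 + \<alpha>) * fst u * fst v,
        ((1 + \<alpha>) / 2) *\<^sub>R (fst u *\<^sub>R snd v + fst v *\<^sub>R snd u)))) (at p)"
proof -
  define c where "c = ((1 + \<alpha>) * fst u * fst v, ((1 + \<alpha>) / 2) *\<^sub>R (fst u *\<^sub>R snd v + fst v *\<^sub>R snd u))"
  have "fst p > 0" using assms by (auto simp: takano_space_def)
  then have "((\<lambda>q. ((1 - \<alpha>) * (snd u \<bullet> snd v) / real CARD('n), 0) - (1 / fst q) *\<^sub>R c) has_derivative
      (\<lambda>w. (fst w / (fst p)\<^sup>2) *\<^sub>R c)) (at p)"
    by (auto intro!: derivative_eq_intros simp: power2_eq_square)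
  moreover have "alpha_christoffel \<alpha> q u v = ((1 - \<alpha>) * (snd u \<bullet> snd v) / real CARD('n), 0) - (1 / fst q) *\<^sub>R c" for q
    by (simp add: alpha_christoffel_def c_def prod_eq_iff vec_eq_iff divide_simps) (simp add: algebra_simps)
  ultimately show ?thesis
    unfolding c_def by simp
qed

lemma smooth_on_alpha_christoffel:
  fixes X Y :: "real \<times> (real ^ 'n) \<Rightarrow> real \<times> (real ^ 'n)"
  assumes X: "smooth_on takano_space X" and Y: "smooth_on takano_space Y"
  shows "smooth_on takano_space (\<lambda>p. alpha_christoffel \<alpha> p (X p) (Y p))"
proof -
  note o = open_takano_space
  note sm = smooth_on_fst_snd[OF o X] smooth_on_fst_snd[OF o Y]
  have inv: "smooth_on takano_space (\<lambda>p::real \<times> (real ^ 'n). inverse (fst p))"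
    by (intro smooth_on_inverse[OF o] smooth_on_fst_snd[OF o smooth_on_ident[OF o]])
      (auto simp: takano_space_def)
  note lin = smooth_on_bounded_linear[OF o bounded_linear_scaleR_right]
  note mult = smooth_on_bounded_bilinear[OF o bounded_bilinear_mult]
    and scale = smooth_on_bounded_bilinear[OF o bounded_bilinear_scaleR]
    and inner = smooth_on_bounded_bilinear[OF o bounded_bilinear_inner]
  have "smooth_on takano_space (\<lambda>p. ((- (1 + \<alpha>)) *\<^sub>R (fst (X p) * fst (Y p) * inverse (fst p)) +
      ((1 - \<alpha>) / real CARD('n)) *\<^sub>R (snd (X p) \<bullet> snd (Y p)),
      (- (1 + \<alpha>) / 2) *\<^sub>R (inverse (fst p) *\<^sub>R (fst (X p) *\<^sub>R snd (Y p) + fst (Y p) *\<^sub>R snd (X p)))))"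
    (is "smooth_on _ ?f")
    by (rule smooth_on_Pair[OF o
          smooth_on_add[OF o lin[OF mult[OF mult[OF sm(1,3)] inv]] lin[OF inner[OF sm(2,4)]]]
          lin[OF scale[OF inv smooth_on_add[OF o scale[OF sm(1,4)] scale[OF sm(3,2)]]]]])
  moreover have "?f = (\<lambda>p. alpha_christoffel \<alpha> p (X p) (Y p))"
    by (simp add: fun_eq_iff alpha_christoffel_def inverse_eq_divide)
  ultimately show ?thesis by simp
qed

text \<open>
  This is the conjugate symmetry of the \<open>\<alpha>\<close>-connection in coordinates: the terms of odd degree in \<open>\<alpha>\<close> are
  symmetric in \<open>u\<close> and \<open>v\<close>, or they cancel between the derivative of the symbols and their products.
\<close>

lemma alpha_curvature_even:
  fixes p :: "real \<times> (real ^ 'n)"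
  assumes "p \<in> takano_space"
  shows "christoffel_curvature (alpha_christoffel \<alpha>) p u v w =
    christoffel_curvature (alpha_christoffel (- \<alpha>)) p u v w"
proof -
  have S: "fst p > 0" using assms by (auto simp: takano_space_def)
  show ?thesis
    unfolding christoffel_curvature_def frechet_derivative_eq[OF alpha_christoffel_has_derivative[OF assms]]
    using S
    by (simp add: alpha_christoffel_def prod_eq_iff vec_eq_iff inner_add_left inner_add_right inner_commute)
      (simp add: field_simps power2_eq_square)
qed

lemma fisher_metric_has_derivative:
  fixes p :: "real \<times> (real ^ 'n)"
  assumes p: "p \<in> takano_space"
  shows "((\<lambda>q. fisher_metric q u v) has_derivative
    (\<lambda>w. - (real CARD('n) * fst u * fst v * fst w / (fst p) ^ 3) - (snd u \<bullet> snd v) * fst w / (fst p)\<^sup>2)) (at p)"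
proof -
  have "fst p > 0" using p by (auto simp: takano_space_def)
  then have "((\<lambda>q. real CARD('n) * fst u * fst v / (2 * (fst q)\<^sup>2) + (snd u \<bullet> snd v) / fst q) has_derivative
    (\<lambda>w. - (real CARD('n) * fst u * fst v * fst w / (fst p) ^ 3) - (snd u \<bullet> snd v) * fst w / (fst p)\<^sup>2)) (at p)"
    by (auto intro!: derivative_eq_intros simp: field_simps power2_eq_square power3_eq_cube)
  then show ?thesis
    by (subst has_derivative_cong_on[OF open_takano_space p fisher_metric_eq])
qed

lemma fisher_metric_nondegenerate:
  fixes u v :: "real \<times> (real ^ 'n)"
  assumes p: "p \<in> takano_space" and eq: "\<And>w. fisher_metric p u w = fisher_metric p v w"
  shows "u = v"
proof -
  have S: "fst p > 0" using p by (auto simp: takano_space_def)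
  have "fst u = fst v"
    using eq[of "(1, 0)"] S by (simp add: fisher_metric_eq[OF p])
  moreover have "snd u \<bullet> m = snd v \<bullet> m" for m
    using eq[of "(0, m)"] S by (simp add: fisher_metric_eq[OF p])
  then have "snd u = snd v"
    using vector_eq_rdot by blast
  ultimately show ?thesis by (simp add: prod_eq_iff)
qed

text \<open>
  For \<open>\<alpha> = 0\<close> the symbols are those of the Levi-Civita connection.
\<close>

lemma alpha_christoffel_0_metric:
  fixes p :: "real \<times> (real ^ 'n)"
  assumes p: "p \<in> takano_space"
  shows "frechet_derivative (\<lambda>q. fisher_metric q v w) (at p) u =
    fisher_metric p (alpha_christoffel 0 p u v) w + fisher_metric p v (alpha_christoffel 0 p u w)"
proof -
  have "fst p > 0" using p by (auto simp: takano_space_def)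
  then show ?thesis
    unfolding frechet_derivative_eq[OF fisher_metric_has_derivative[OF p]] fisher_metric_eq[OF p]
    by (simp add: alpha_christoffel_def inner_add_left inner_add_right inner_commute)
      (simp add: field_simps power2_eq_square power3_eq_cube)
qed

text \<open>
  Any torsion-free connection with symbols \<open>\<Gamma>\<^sup>0 + K\<close> and totally symmetric \<open>g(K(u, v), w)\<close> satisfies \<open>\<nabla>g = -2 g(K(u, v), w)\<close>;
  so this identity singles out the \<open>\<alpha>\<close>-symbols.
\<close>

lemma alpha_christoffel_amari_chentsov:
  fixes p :: "real \<times> (real ^ 'n)"
  assumes p: "p \<in> takano_space"
  shows "amari_chentsov_tensor \<alpha> p u v w =
    - 2 * fisher_metric p (alpha_christoffel \<alpha> p u v - alpha_christoffel 0 p u v) w"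
proof -
  have "fst p > 0" using p by (auto simp: takano_space_def)
  then show ?thesis
    unfolding amari_chentsov_tensor_eq[OF p] fisher_metric_eq[OF p]
    by (simp add: alpha_christoffel_def inner_add_left inner_add_right inner_diff_left inner_commute)
      (simp add: field_simps power2_eq_square power3_eq_cube)
qed

lemma alpha_christoffel_uminus:
  "alpha_christoffel (- \<alpha>) p u v = alpha_christoffel \<alpha> p u v -
     2 *\<^sub>R (alpha_christoffel \<alpha> p u v - alpha_christoffel 0 p u v)"
  by (simp add: alpha_christoffel_def prod_eq_iff vec_eq_iff divide_simps) (simp add: algebra_simps)


section \<open>The affine action\<close>

text \<open>
  The differential of \<open>affine_action a b\<close>, which is the same at every point.
\<close>

definition affine_scaling :: "real \<Rightarrow> real \<times> (real ^ 'n) \<Rightarrow> real \<times> (real ^ 'n)" where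
  "affine_scaling a u = (a\<^sup>2 * fst u, a *\<^sub>R snd u)"

lemma bounded_linear_affine_scaling: "bounded_linear (affine_scaling a)"
  unfolding affine_scaling_def
  by (intro bounded_linear_Pair bounded_linear_compose[OF bounded_linear_mult_right bounded_linear_fst]
      bounded_linear_compose[OF bounded_linear_scaleR_right bounded_linear_snd])

lemma affine_action_eq_scaling: "affine_action a b p = affine_scaling a p + (0, b)"
  by (simp add: affine_action_def affine_scaling_def)

lemma affine_action_in_takano: "a > 0 \<Longrightarrow> affine_action a b p \<in> takano_space \<longleftrightarrow> p \<in> takano_space"
  by (auto simp: affine_action_def takano_space_def mem_Times_iff zero_less_mult_iff)

abbreviation affine_action_inv :: "real \<Rightarrow> real ^ 'n \<Rightarrow> real \<times> (real ^ 'n) \<Rightarrow> real \<times> (real ^ 'n)" where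
  "affine_action_inv a b \<equiv> affine_action (1 / a) (- ((1 / a) *\<^sub>R b))"

lemma affine_action_inverse:
  assumes "a > 0"
  shows "affine_action a b (affine_action_inv a b q) = q" "affine_action_inv a b (affine_action a b q) = q"
  using assms by (simp_all add: affine_action_def prod_eq_iff power_divide scaleR_right_diff_distrib scaleR_right_distrib)

lemma affine_scaling_inverse:
  assumes "a > 0"
  shows "affine_scaling a (affine_scaling (1 / a) q) = q" "affine_scaling (1 / a) (affine_scaling a q) = q"
  using assms by (simp_all add: affine_scaling_def prod_eq_iff power_divide)

text \<open>
  The affine group preserves the Fisher metric and the Amari--Chentsov tensor, hence the connections that they
  define; in coordinates this is a homogeneity property of the symbols.
\<close>

lemma alpha_christoffel_equivariant:
  fixes p :: "real \<times> (real ^ 'n)"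
  assumes a: "a > 0" and p: "p \<in> takano_space"
  shows "alpha_christoffel \<alpha> (affine_action a b p) (affine_scaling a u) (affine_scaling a v) =
    affine_scaling a (alpha_christoffel \<alpha> p u v)"
proof -
  have "fst p > 0" using p by (auto simp: takano_space_def)
  then show ?thesis
    using a by (simp add: alpha_christoffel_def affine_scaling_def affine_action_def prod_eq_iff vec_eq_iff)
      (simp add: field_simps power2_eq_square)
qed

lemma pushforward_affine_action:
  fixes X :: "real \<times> (real ^ 'n) \<Rightarrow> real \<times> (real ^ 'n)"
  assumes a: "a > 0" and q: "q \<in> takano_space"
  shows "pushforward_field takano_space (affine_action a b) X q =
    affine_scaling a (X (affine_action_inv a b q))"
proof -
  have "inj_on (affine_action a b) takano_space"
    by (rule inj_on_inverseI[of _ "affine_action_inv a b"]) (simp add: affine_action_inverse[OF a])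
  moreover have "affine_action_inv a b q \<in> takano_space"
    using a q by (subst affine_action_in_takano) simp_all
  ultimately have inv: "inv_into takano_space (affine_action a b) q = affine_action_inv a b q"
    by (intro inv_into_f_eq) (simp_all add: affine_action_inverse[OF a])
  have "(affine_action a b has_derivative affine_scaling a) (at r)" for r
    unfolding affine_action_eq_scaling[abs_def]
    by (intro has_derivative_add_const bounded_linear_imp_has_derivative bounded_linear_affine_scaling)
  then have "frechet_derivative (affine_action a b) (at r) = affine_scaling a" for r
    by (rule frechet_derivative_eq)
  with inv show ?thesis
    by (simp add: pushforward_field_def)
qed

lemma pushforward_vector_field:
  fixes X :: "real \<times> (real ^ 'n) \<Rightarrow> real \<times> (real ^ 'n)"
  assumes a: "a > 0" and X: "X \<in> vector_fields takano_space"
  shows "pushforward_field takano_space (affine_action a b) X \<in> vector_fields takano_space"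
proof -
  have "smooth_on takano_space (\<lambda>q. X (affine_scaling (1 / a) q + (0, - ((1 / a) *\<^sub>R b))))"
    by (rule smooth_on_compose_affine[OF open_takano_space open_takano_space bounded_linear_affine_scaling])
      (use a X in \<open>simp_all add: affine_action_in_takano vector_fields_def flip: affine_action_eq_scaling\<close>)
  then have "smooth_on takano_space (\<lambda>q. affine_scaling a (X (affine_action_inv a b q)))"
    unfolding affine_action_eq_scaling
    by (rule smooth_on_bounded_linear[OF open_takano_space bounded_linear_affine_scaling])
  then show ?thesis
    using smooth_on_cong[OF open_takano_space, of "pushforward_field takano_space (affine_action a b) X"
        "\<lambda>q. affine_scaling a (X (affine_action_inv a b q))"]
    by (simp add: vector_fields_def pushforward_affine_action[OF a])
qed

lemma dir_deriv_pushforward: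
  fixes X Y :: "real \<times> (real ^ 'n) \<Rightarrow> real \<times> (real ^ 'n)"
  assumes a: "a > 0" and Y: "Y \<in> vector_fields takano_space" and p: "p \<in> takano_space"
  shows "dir_deriv (pushforward_field takano_space (affine_action a b) X)
      (pushforward_field takano_space (affine_action a b) Y) p =
    affine_scaling a (dir_deriv X Y (affine_action_inv a b p))"
proof -
  let ?\<psi> = "affine_action_inv a b"
  have \<psi>p: "?\<psi> p \<in> takano_space"
    using a p by (subst affine_action_in_takano) simp_all
  have "(Y has_derivative frechet_derivative Y (at (?\<psi> p))) (at (?\<psi> p))"
    by (intro has_derivative_frechet vector_field_differentiable[OF Y \<psi>p])
  moreover have "(?\<psi> has_derivative affine_scaling (1 / a)) (at p)"
    unfolding affine_action_eq_scaling[abs_def]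
    by (intro has_derivative_add_const bounded_linear_imp_has_derivative bounded_linear_affine_scaling)
  ultimately have "((\<lambda>q. Y (?\<psi> q)) has_derivative
      (\<lambda>w. frechet_derivative Y (at (?\<psi> p)) (affine_scaling (1 / a) w))) (at p)"
    by (rule has_derivative_compose[rotated])
  from bounded_linear.has_derivative[OF bounded_linear_affine_scaling this]
  have "((\<lambda>q. affine_scaling a (Y (?\<psi> q))) has_derivative
      (\<lambda>w. affine_scaling a (frechet_derivative Y (at (?\<psi> p)) (affine_scaling (1 / a) w)))) (at p)" .
  then have "(pushforward_field takano_space (affine_action a b) Y has_derivative
      (\<lambda>w. affine_scaling a (frechet_derivative Y (at (?\<psi> p)) (affine_scaling (1 / a) w)))) (at p)"
    by (subst has_derivative_cong_on[OF open_takano_space p pushforward_affine_action[OF a]])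
  then have "dir_deriv (pushforward_field takano_space (affine_action a b) X)
      (pushforward_field takano_space (affine_action a b) Y) p =
    affine_scaling a (frechet_derivative Y (at (?\<psi> p))
      (affine_scaling (1 / a) (pushforward_field takano_space (affine_action a b) X p)))"
    by (rule dir_deriv_eq)
  then show ?thesis
    unfolding pushforward_affine_action[OF a p] affine_scaling_inverse[OF a]
    by (simp add: dir_deriv_def)
qed

lemma affine_action_origin:
  assumes "q \<in> takano_space"
  shows "affine_action (sqrt (fst q)) (snd q) (1, 0) = q"
  using assms by (auto simp: affine_action_def takano_space_def prod_eq_iff)

lemma alpha_christoffel_from_origin:
  assumes q: "q \<in> takano_space"
  shows "alpha_christoffel \<alpha> q u v = affine_scaling (sqrt (fst q))
    (alpha_christoffel \<alpha> (1, 0) (affine_scaling (1 / sqrt (fst q)) u) (affine_scaling (1 / sqrt (fst q)) v))"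
proof -
  have a: "sqrt (fst q) > 0"
    using q by (auto simp: takano_space_def)
  show ?thesis
    using alpha_christoffel_equivariant[OF a, of "(1, 0)" \<alpha> "snd q" "affine_scaling (1 / sqrt (fst q)) u"
        "affine_scaling (1 / sqrt (fst q)) v"]
    by (simp add: takano_space_def affine_action_origin[OF q] affine_scaling_inverse[OF a])
qed


section \<open>The difference tensor of a statistical connection\<close>

text \<open>
  The deviation from the Levi-Civita connection.
\<close>

definition difference_tensor ::
    "(real \<times> (real ^ 'n)) conn \<Rightarrow> real \<times> (real ^ 'n) \<Rightarrow> real \<times> (real ^ 'n) \<Rightarrow> real \<times> (real ^ 'n) \<Rightarrow> real \<times> (real ^ 'n)"
  where "difference_tensor D p u v = christoffel D p u v - alpha_christoffel 0 p u v"

context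
  fixes D :: "(real \<times> (real ^ 'n)) conn"
  assumes D: "statistical_structure takano_space fisher_metric D"
begin

lemma affine_conn: "affine_connection takano_space D"
  using D by (simp add: statistical_structure_def)

lemma riemannian_fisher: "riemannian_metric takano_space (fisher_metric :: (real \<times> (real ^ 'n)) metric)"
  using D by (simp add: statistical_structure_def)

lemma bilinear_fisher: "p \<in> takano_space \<Longrightarrow> bilinear (fisher_metric p :: real \<times> (real ^ 'n) \<Rightarrow> _)"
  using riemannian_fisher by (simp add: riemannian_metric_def)

lemma fisher_commute:
  "p \<in> takano_space \<Longrightarrow> fisher_metric p u v = fisher_metric p v (u :: real \<times> (real ^ 'n))"
  using riemannian_fisher unfolding riemannian_metric_def by blast

lemma bilinear_difference: 
  assumes "p \<in> takano_space"
  shows "bilinear (difference_tensor D p)"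
proof -
  note b = bilinear_christoffel[OF open_takano_space affine_conn assms] bilinear_alpha_christoffel[of 0 p]
  show ?thesis
    unfolding bilinear_def linear_iff difference_tensor_def
    by (simp add: b[THEN bilinear_ladd] b[THEN bilinear_radd] b[THEN bilinear_lmul] b[THEN bilinear_rmul]
        algebra_simps)
qed

lemma difference_commute:
  assumes "p \<in> takano_space"
  shows "difference_tensor D p u v = difference_tensor D p v u"
proof -
  have "torsion_free takano_space D"
    using D by (simp add: statistical_structure_def)
  then have "D (\<lambda>_. u) (\<lambda>_. v) p - D (\<lambda>_. v) (\<lambda>_. u) p = lie_bracket (\<lambda>_. u) (\<lambda>_. v) p"
    unfolding torsion_free_def using const_vector_field assms by blast
  then show ?thesis
    by (simp add: difference_tensor_def christoffel_def lie_bracket_def dir_deriv_const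
        alpha_christoffel_commute[of 0 p u v])
qed

lemma cov_deriv_fisher:
  assumes "X \<in> vector_fields takano_space" "Y \<in> vector_fields takano_space" "Z \<in> vector_fields takano_space"
    and p: "p \<in> takano_space"
  shows "cov_deriv_metric D fisher_metric X Y Z p =
    - fisher_metric p (difference_tensor D p (X p) (Y p)) (Z p) -
      fisher_metric p (Y p) (difference_tensor D p (X p) (Z p))"
  unfolding cov_deriv_metric_tensorial[OF open_takano_space affine_conn riemannian_fisher assms]
    alpha_christoffel_0_metric[OF p] difference_tensor_def
  by (simp add: bilinear_lsub[OF bilinear_fisher[OF p]] bilinear_rsub[OF bilinear_fisher[OF p]])

text \<open>
  The Levi-Civita symbols do not contribute to the covariant derivative of the metric, which is therefore
  \<open>-g(K(u, v), w) - g(v, K(u, w))\<close> for the difference tensor \<open>K\<close>. Exchanging the first two arguments and using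
  \<open>K(u, v) = K(v, u)\<close> leaves the claimed symmetry.
\<close>

lemma difference_totally_symmetric:
  assumes p: "p \<in> takano_space"
  shows "fisher_metric p (difference_tensor D p u v) w = fisher_metric p (difference_tensor D p u w) v"
proof -
  have "cov_deriv_metric D fisher_metric (\<lambda>_. v) (\<lambda>_. w) (\<lambda>_. u) p =
      cov_deriv_metric D fisher_metric (\<lambda>_. w) (\<lambda>_. v) (\<lambda>_. u) p"
    using D p const_vector_field unfolding statistical_structure_def by blast
  then show ?thesis
    unfolding cov_deriv_fisher[OF const_vector_field const_vector_field const_vector_field p]
    using difference_commute[OF p] fisher_commute[OF p] by (metis add_left_cancel diff_conv_add_uminus neg_equal_iff_equal)
qed

lemma cov_deriv_fisher_eq:
  assumes "X \<in> vector_fields takano_space" "Y \<in> vector_fields takano_space" "Z \<in> vector_fields takano_space"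
    and p: "p \<in> takano_space"
  shows "cov_deriv_metric D fisher_metric X Y Z p = - 2 * fisher_metric p (difference_tensor D p (X p) (Y p)) (Z p)"
  unfolding cov_deriv_fisher[OF assms] fisher_commute[OF p, of "Y p"]
  using difference_totally_symmetric[OF p, of "X p" "Y p" "Z p"] by simp

text \<open>
  The covariant derivative of the metric is \<open>-2 g(K(u, v), w)\<close>, so by nondegeneracy it determines \<open>K\<close> and
  with it the connection.
\<close>

lemma amari_chentsov_iff_christoffel:
  "amari_chentsov_connection \<alpha> D \<longleftrightarrow>
    (\<forall>p\<in>takano_space. \<forall>u v. christoffel D p u v = alpha_christoffel \<alpha> p u v)"
proof
  assume \<alpha>: "amari_chentsov_connection \<alpha> D"
  show "\<forall>p\<in>takano_space. \<forall>u v. christoffel D p u v = alpha_christoffel \<alpha> p u v"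
  proof (intro ballI allI)
    fix p :: "real \<times> (real ^ 'n)" and u v assume p: "p \<in> takano_space"
    have "fisher_metric p (difference_tensor D p u v) w =
        fisher_metric p (alpha_christoffel \<alpha> p u v - alpha_christoffel 0 p u v) w" for w
    proof -
      have "cov_deriv_metric D fisher_metric (\<lambda>_. u) (\<lambda>_. v) (\<lambda>_. w) p = amari_chentsov_tensor \<alpha> p u v w"
        using \<alpha> p const_vector_field unfolding amari_chentsov_connection_def by blast
      then show ?thesis
        unfolding cov_deriv_fisher_eq[OF const_vector_field const_vector_field const_vector_field p]
          alpha_christoffel_amari_chentsov[OF p] by simp
    qed
    from fisher_metric_nondegenerate[OF p this]
    show "christoffel D p u v = alpha_christoffel \<alpha> p u v"
      by (simp add: difference_tensor_def)
  qed
next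
  assume *: "\<forall>p\<in>takano_space. \<forall>u v. christoffel D p u v = alpha_christoffel \<alpha> p u v"
  show "amari_chentsov_connection \<alpha> D"
    unfolding amari_chentsov_connection_def
  proof (intro conjI D ballI)
    fix X Y Z :: "real \<times> (real ^ 'n) \<Rightarrow> real \<times> (real ^ 'n)" and p :: "real \<times> (real ^ 'n)"
    assume XYZ: "X \<in> vector_fields takano_space" "Y \<in> vector_fields takano_space" "Z \<in> vector_fields takano_space"
      and p: "p \<in> takano_space"
    show "cov_deriv_metric D fisher_metric X Y Z p = amari_chentsov_tensor \<alpha> p (X p) (Y p) (Z p)"
      unfolding cov_deriv_fisher_eq[OF XYZ p] alpha_christoffel_amari_chentsov[OF p]
      by (simp only: difference_tensor_def *[rule_format, OF p])
  qed
qed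


section \<open>Symmetries of the Amari--Chentsov connections\<close>

lemma invariant_if_alpha:
  assumes \<alpha>: "\<And>p u v. p \<in> takano_space \<Longrightarrow> christoffel D p u v = alpha_christoffel \<alpha> p u v"
  shows "invariant_connection takano_space affine_group D"
  unfolding invariant_connection_def
proof (intro ballI)
  fix \<phi> X Y :: "real \<times> (real ^ 'n) \<Rightarrow> real \<times> (real ^ 'n)" and p :: "real \<times> (real ^ 'n)"
  assume "\<phi> \<in> affine_group" and X: "X \<in> vector_fields takano_space" and Y: "Y \<in> vector_fields takano_space"
    and p: "p \<in> takano_space"
  then obtain a b where a: "a > 0" and \<phi>: "\<phi> = affine_action a b"
    by (auto simp: affine_group_def)
  let ?q = "affine_action_inv a b p"
  have q: "?q \<in> takano_space"
    using a p by (subst affine_action_in_takano) simp_all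
  note eq = affine_connection_eq_christoffel[OF open_takano_space affine_conn]
  have "D (pushforward_field takano_space \<phi> X) (pushforward_field takano_space \<phi> Y) p =
      affine_scaling a (dir_deriv X Y ?q) +
      alpha_christoffel \<alpha> p (affine_scaling a (X ?q)) (affine_scaling a (Y ?q))"
    unfolding \<phi> eq[OF pushforward_vector_field[OF a X] pushforward_vector_field[OF a Y] p]
      dir_deriv_pushforward[OF a Y p] \<alpha>[OF p] pushforward_affine_action[OF a p] ..
  also have "\<dots> = affine_scaling a (dir_deriv X Y ?q + alpha_christoffel \<alpha> ?q (X ?q) (Y ?q))"
    using alpha_christoffel_equivariant[OF a q, of \<alpha> b "X ?q" "Y ?q"]
    by (simp add: affine_action_inverse[OF a] linear_add[OF bounded_linear.linear[OF bounded_linear_affine_scaling]])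
  also have "\<dots> = pushforward_field takano_space \<phi> (D X Y) p"
    unfolding \<phi> pushforward_affine_action[OF a p] eq[OF X Y q] \<alpha>[OF q] ..
  finally show "D (pushforward_field takano_space \<phi> X) (pushforward_field takano_space \<phi> Y) p =
      pushforward_field takano_space \<phi> (D X Y) p" .
qed

text \<open>
  The dual connection is obtained from \<open>D\<close> by adding the difference of the symbols for \<open>-\<alpha>\<close> and \<open>\<alpha>\<close>.
  Since this difference is a tensor field, the axioms of a connection carry over from \<open>D\<close>.
\<close>

lemma conjugate_symmetric_if_alpha:
  assumes \<alpha>: "\<And>p u v. p \<in> takano_space \<Longrightarrow> christoffel D p u v = alpha_christoffel \<alpha> p u v"
  shows "conjugate_symmetric takano_space fisher_metric D"
proof -
  let ?V = "vector_fields takano_space :: (real \<times> (real ^ 'n) \<Rightarrow> real \<times> (real ^ 'n)) set"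
  define P where "P p u v = alpha_christoffel (- \<alpha>) p u v - alpha_christoffel \<alpha> p u v"
    for p u v :: "real \<times> (real ^ 'n)"
  define D' where "D' X Y p = D X Y p + P p (X p) (Y p)" for X Y p
  note o = open_takano_space
  have P_bilinear: "bilinear (P p)" for p
  proof -
    note b = bilinear_alpha_christoffel[of "- \<alpha>" p] bilinear_alpha_christoffel[of \<alpha> p]
    show ?thesis
      unfolding bilinear_def linear_iff P_def
      by (simp add: b[THEN bilinear_ladd] b[THEN bilinear_radd] b[THEN bilinear_lmul] b[THEN bilinear_rmul]
          algebra_simps)
  qed
  note P_simps = bilinear_ladd[OF P_bilinear] bilinear_radd[OF P_bilinear]
    bilinear_lmul[OF P_bilinear] bilinear_rmul[OF P_bilinear]
  have closed: "D' X Y \<in> ?V" if "X \<in> ?V" "Y \<in> ?V" for X Y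
  proof -
    have "smooth_on takano_space (D X Y)"
      using affine_connection_closed[OF affine_conn that] by (simp add: vector_fields_def)
    moreover have "smooth_on takano_space (\<lambda>p. alpha_christoffel \<beta> p (X p) (Y p))" for \<beta>
      using that by (intro smooth_on_alpha_christoffel) (simp_all add: vector_fields_def)
    moreover from this[of \<alpha>] have "smooth_on takano_space (\<lambda>p. - alpha_christoffel \<alpha> p (X p) (Y p))"
      by (rule smooth_on_bounded_linear[OF o bounded_linear_minus[OF bounded_linear_ident]])
    ultimately have "smooth_on takano_space (\<lambda>p. D X Y p + (alpha_christoffel (- \<alpha>) p (X p) (Y p) +
        - alpha_christoffel \<alpha> p (X p) (Y p)))"
      by (intro smooth_on_add[OF o]) simp_all
    then show ?thesis
      by (simp add: vector_fields_def D'_def[abs_def] P_def)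
  qed
  have D': "affine_connection takano_space D'"
    unfolding affine_connection_def
  proof (intro conjI ballI allI impI)
    show "D' X Y \<in> ?V" if "X \<in> ?V" "Y \<in> ?V" for X Y
      using closed that .
    show "D' X Y p = D' X' Y' p"
      if "X \<in> ?V" "X' \<in> ?V" "Y \<in> ?V" "Y' \<in> ?V" "\<forall>p\<in>takano_space. X p = X' p \<and> Y p = Y' p" "p \<in> takano_space"
      for X X' Y Y' p
      using affine_connection_cong[OF affine_conn that(1-4) _ that(6)] that(5,6) by (simp add: D'_def)
    show "D' (\<lambda>q. X q + X' q) Y p = D' X Y p + D' X' Y p"
      if "X \<in> ?V" "X' \<in> ?V" "Y \<in> ?V" "p \<in> takano_space" for X X' Y p
      using affine_connection_add_left[OF affine_conn that] by (simp add: D'_def P_simps)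
    show "D' (\<lambda>q. f q *\<^sub>R X q) Y p = f p *\<^sub>R D' X Y p"
      if "X \<in> ?V" "Y \<in> ?V" "smooth_on takano_space f" "p \<in> takano_space" for f X Y p
      using affine_connection_scale_left[OF affine_conn that] by (simp add: D'_def P_simps scaleR_add_right)
    show "D' X (\<lambda>q. Y q + Y' q) p = D' X Y p + D' X Y' p"
      if "X \<in> ?V" "Y \<in> ?V" "Y' \<in> ?V" "p \<in> takano_space" for X Y Y' p
      using affine_connection_add_right[OF affine_conn that] by (simp add: D'_def P_simps)
    show "D' X (\<lambda>q. f q *\<^sub>R Y q) p = dir_deriv X f p *\<^sub>R Y p + f p *\<^sub>R D' X Y p"
      if "X \<in> ?V" "Y \<in> ?V" "smooth_on takano_space f" "p \<in> takano_space" for f X Y p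
      using affine_connection_Leibniz[OF affine_conn that] by (simp add: D'_def P_simps scaleR_add_right)
  qed
  have "dual_connection takano_space fisher_metric D D'"
    unfolding dual_connection_def
  proof (intro conjI D' ballI)
    fix X Y Z :: "real \<times> (real ^ 'n) \<Rightarrow> real \<times> (real ^ 'n)" and p :: "real \<times> (real ^ 'n)"
    assume X: "X \<in> ?V" and Y: "Y \<in> ?V" and Z: "Z \<in> ?V" and p: "p \<in> takano_space"
    note g = bilinear_fisher[OF p]
    have "P p (X p) (Z p) = - 2 *\<^sub>R difference_tensor D p (X p) (Z p)"
      by (simp add: P_def alpha_christoffel_uminus[of \<alpha>] difference_tensor_def \<alpha>[OF p])
    then have "fisher_metric p (Y p) (P p (X p) (Z p)) =
        - 2 * fisher_metric p (difference_tensor D p (X p) (Y p)) (Z p)"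
      using difference_totally_symmetric[OF p, of "X p" "Y p" "Z p"]
      by (simp only: bilinear_rmul[OF g] fisher_commute[OF p, of "Y p"]) simp
    then show "dir_deriv X (\<lambda>q. fisher_metric q (Y q) (Z q)) p =
        fisher_metric p (D X Y p) (Z p) + fisher_metric p (Y p) (D' X Z p)"
      using cov_deriv_fisher_eq[OF X Y Z p] unfolding cov_deriv_metric_def D'_def
      by (simp add: bilinear_radd[OF g])
  qed
  moreover have "curvature D X Y Z p = curvature D' X Y Z p"
    if "X \<in> ?V" "Y \<in> ?V" "Z \<in> ?V" and p: "p \<in> takano_space" for X Y Z p
  proof -
    have \<alpha>': "christoffel D' q u v = alpha_christoffel (- \<alpha>) q u v" if "q \<in> takano_space" for q u v
      using \<alpha>[OF that, of u v] by (simp add: christoffel_def D'_def P_def)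
    have "christoffel_curvature (christoffel D) p u v w = christoffel_curvature (christoffel D') p u v w" for u v w
    proof -
      have "christoffel_curvature (christoffel D) p u v w = christoffel_curvature (alpha_christoffel \<alpha>) p u v w"
        by (rule christoffel_curvature_cong[OF o p \<alpha>])
      also have "\<dots> = christoffel_curvature (alpha_christoffel (- \<alpha>)) p u v w"
        by (rule alpha_curvature_even[OF p])
      also have "\<dots> = christoffel_curvature (christoffel D') p u v w"
        by (rule christoffel_curvature_cong[OF o p \<alpha>', symmetric])
      finally show ?thesis .
    qed
    then show ?thesis
      unfolding curvature_eq_christoffel[OF o affine_conn that] curvature_eq_christoffel[OF o D' that] by simp
  qed
  ultimately show ?thesis
    unfolding conjugate_symmetric_def by blast
qed


section \<open>Invariant conjugate symmetric connections\<close>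

text \<open>
  The symbols of \<open>D\<close> and of its dual are \<open>\<Gamma>\<^sup>0 + K\<close> and \<open>\<Gamma>\<^sup>0 - K\<close>. In the difference of the two curvatures
  the terms of even degree in \<open>K\<close> cancel, and twice the linear part remains. The equation says that the
  Levi-Civita derivative \<open>(\<nabla>\<^sup>0\<^sub>u K)(v, w)\<close> is symmetric in \<open>u\<close> and \<open>v\<close>; its term
  \<open>K(\<nabla>\<^sup>0\<^sub>u v, w)\<close> is symmetric already and does not appear.
\<close>

lemma conjugate_symmetric_Codazzi:
  assumes "conjugate_symmetric takano_space fisher_metric D" and p: "p \<in> takano_space"
  shows "frechet_derivative (\<lambda>q. difference_tensor D q v w) (at p) u +
      alpha_christoffel 0 p u (difference_tensor D p v w) + difference_tensor D p u (alpha_christoffel 0 p v w) =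
    frechet_derivative (\<lambda>q. difference_tensor D q u w) (at p) v +
      alpha_christoffel 0 p v (difference_tensor D p u w) + difference_tensor D p v (alpha_christoffel 0 p u w)"
proof -
  note o = open_takano_space
  let ?A = "alpha_christoffel 0" and ?K = "difference_tensor D"
  obtain D' where dual: "dual_connection takano_space fisher_metric D D'"
    and R: "\<And>X Y Z p. \<lbrakk>X \<in> vector_fields takano_space; Y \<in> vector_fields takano_space; Z \<in> vector_fields takano_space;
      p \<in> takano_space\<rbrakk> \<Longrightarrow> curvature D X Y Z p = curvature D' X Y Z p"
    using assms(1) unfolding conjugate_symmetric_def by blast
  have D': "affine_connection takano_space D'"
    using dual by (simp add: dual_connection_def)
  have plus: "christoffel D q x y = ?A q x y + ?K q x y" for q x y
    by (simp add: difference_tensor_def)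
  have minus: "christoffel D' q x y = ?A q x y - ?K q x y" if q: "q \<in> takano_space" for q x y
  proof (rule fisher_metric_nondegenerate[OF q])
    fix z
    have "dir_deriv (\<lambda>_. x) (\<lambda>q. fisher_metric q z y) q =
        fisher_metric q (christoffel D q x z) y + fisher_metric q z (christoffel D' q x y)"
      unfolding christoffel_def
      by (rule dual[unfolded dual_connection_def, THEN conjunct2, rule_format,
            OF const_vector_field const_vector_field const_vector_field q])
    then have "fisher_metric q z (christoffel D' q x y) = fisher_metric q z (?A q x y) - fisher_metric q (?K q x z) y"
      using alpha_christoffel_0_metric[OF q, of z y x]
      by (simp add: dir_deriv_def plus bilinear_ladd[OF bilinear_fisher[OF q]])
    then show "fisher_metric q (christoffel D' q x y) z = fisher_metric q (?A q x y - ?K q x y) z"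
      using difference_totally_symmetric[OF q, of x y z]
      by (simp add: fisher_commute[OF q, of z] bilinear_lsub[OF bilinear_fisher[OF q]])
  qed
  have A_diff: "(\<lambda>q. ?A q x y) differentiable (at p)" for x y
    by (rule differentiableI[OF alpha_christoffel_has_derivative[OF p]])
  have K_diff: "(\<lambda>q. ?K q x y) differentiable (at p)" for x y
    unfolding difference_tensor_def
    by (intro differentiable_diff A_diff christoffel_differentiable[OF o affine_conn p])
  define dA where "dA x y = frechet_derivative (\<lambda>q. ?A q x y) (at p)" for x y
  define dK where "dK x y = frechet_derivative (\<lambda>q. ?K q x y) (at p)" for x y
  have dp: "frechet_derivative (\<lambda>q. ?A q x y + ?K q x y) (at p) = (\<lambda>w. dA x y w + dK x y w)" for x y
    unfolding dA_def dK_def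
    by (intro frechet_derivative_eq has_derivative_add has_derivative_frechet A_diff K_diff)
  have dm: "frechet_derivative (\<lambda>q. ?A q x y - ?K q x y) (at p) = (\<lambda>w. dA x y w - dK x y w)" for x y
    unfolding dA_def dK_def
    by (intro frechet_derivative_eq has_derivative_diff has_derivative_frechet A_diff K_diff)
  note b = bilinear_alpha_christoffel[of 0 p] bilinear_difference[OF p]
  have "christoffel_curvature (christoffel D) p u v w = christoffel_curvature (christoffel D') p u v w"
    using R[OF const_vector_field const_vector_field const_vector_field p, of u v w]
    unfolding curvature_eq_christoffel[OF o affine_conn const_vector_field const_vector_field const_vector_field p]
      curvature_eq_christoffel[OF o D' const_vector_field const_vector_field const_vector_field p]
    by simp
  moreover have "christoffel_curvature (christoffel D) p u v w =
      christoffel_curvature (\<lambda>q x y. ?A q x y + ?K q x y) p u v w"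
    by (rule christoffel_curvature_cong[OF o p plus])
  moreover have "christoffel_curvature (christoffel D') p u v w =
      christoffel_curvature (\<lambda>q x y. ?A q x y - ?K q x y) p u v w"
    by (rule christoffel_curvature_cong[OF o p minus])
  ultimately have "christoffel_curvature (\<lambda>q x y. ?A q x y + ?K q x y) p u v w =
      christoffel_curvature (\<lambda>q x y. ?A q x y - ?K q x y) p u v w"
    by simp
  then have "2 *\<^sub>R (dK v w u + ?A p u (?K p v w) + ?K p u (?A p v w)) =
      2 *\<^sub>R (dK u w v + ?A p v (?K p u w) + ?K p v (?A p u w))"
    unfolding christoffel_curvature_def dp dm
    by (simp add: b[THEN bilinear_radd] b[THEN bilinear_rsub] algebra_simps scaleR_2)
  then show ?thesis
    by (simp add: dK_def)
qed

text \<open>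
  The push-forward of a constant field under an affine map is again a constant field.
\<close>

lemma invariant_christoffel:
  assumes inv: "invariant_connection takano_space affine_group D"
    and a: "a > 0" and p: "p \<in> takano_space"
  shows "christoffel D (affine_action a b p) (affine_scaling a u) (affine_scaling a v) =
    affine_scaling a (christoffel D p u v)"
proof -
  let ?\<phi> = "affine_action a b" and ?U = "takano_space :: (real \<times> (real ^ 'n)) set"
  have \<phi>p: "?\<phi> p \<in> ?U"
    using a p by (simp add: affine_action_in_takano)
  have "?\<phi> \<in> affine_group"
    using a by (auto simp: affine_group_def)
  then have "D (pushforward_field ?U ?\<phi> (\<lambda>_. u)) (pushforward_field ?U ?\<phi> (\<lambda>_. v)) (?\<phi> p) =
      pushforward_field ?U ?\<phi> (D (\<lambda>_. u) (\<lambda>_. v)) (?\<phi> p)"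
    using inv \<phi>p const_vector_field unfolding invariant_connection_def by blast
  moreover have "D (pushforward_field ?U ?\<phi> (\<lambda>_. u)) (pushforward_field ?U ?\<phi> (\<lambda>_. v)) (?\<phi> p) =
      D (\<lambda>_. affine_scaling a u) (\<lambda>_. affine_scaling a v) (?\<phi> p)"
    by (rule affine_connection_cong[OF affine_conn])
      (simp_all add: pushforward_vector_field[OF a] const_vector_field pushforward_affine_action[OF a] \<phi>p)
  ultimately show ?thesis
    by (simp add: christoffel_def pushforward_affine_action[OF a \<phi>p] affine_action_inverse[OF a])
qed

end

text \<open>
  On the whole space \<open>f\<close> equals its composition with the projection onto the half-line of fixed mean, whose
  differential annihilates \<open>(0, m)\<close>.
\<close>

lemma frechet_derivative_mean_direction:
  fixes f :: "real \<times> (real ^ 'n) \<Rightarrow> 'b::real_normed_vector"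
  assumes p: "p \<in> takano_space" and diff: "f differentiable (at p)"
    and f: "\<And>q. q \<in> takano_space \<Longrightarrow> f q = h (fst q)"
  shows "frechet_derivative f (at p) (0, m) = 0"
proof -
  let ?f' = "frechet_derivative f (at p)"
  have f': "(f has_derivative ?f') (at p)"
    by (rule has_derivative_frechet[OF diff])
  have "((\<lambda>q. (fst q, snd p)) has_derivative (\<lambda>w. (fst w, 0))) (at p)"
    by (intro has_derivative_Pair has_derivative_fst has_derivative_ident has_derivative_const)
  moreover have "(f has_derivative ?f') (at (fst p, snd p))"
    using f' by simp
  ultimately have "((\<lambda>q. f (fst q, snd p)) has_derivative (\<lambda>w. ?f' (fst w, 0))) (at p)"
    by (rule has_derivative_compose)
  moreover have "f (fst q, snd p) = f q" if "q \<in> takano_space" for q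
  proof -
    have "(fst q, snd p) \<in> takano_space"
      using that by (simp add: takano_space_def mem_Times_iff)
    then show ?thesis
      using f that by simp
  qed
  ultimately have "(f has_derivative (\<lambda>w. ?f' (fst w, 0))) (at p)"
    by (rule has_derivative_transform_within_open[OF _ open_takano_space p])
  from fun_cong[OF has_derivative_unique[OF f' this], of "(0, m)"]
  have "?f' (0, m) = ?f' 0"
    by (simp add: zero_prod_def)
  then show ?thesis
    by (simp add: linear_0[OF linear_frechet_derivative[OF diff]])
qed

context
  fixes D :: "(real \<times> (real ^ 'n)) conn"
  assumes D: "statistical_structure takano_space fisher_metric D"
    and inv: "invariant_connection takano_space affine_group D"
begin

lemma christoffel_from_origin:
  assumes q: "q \<in> takano_space"
  shows "christoffel D q u v = affine_scaling (sqrt (fst q))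
    (christoffel D (1, 0) (affine_scaling (1 / sqrt (fst q)) u) (affine_scaling (1 / sqrt (fst q)) v))"
proof -
  have a: "sqrt (fst q) > 0"
    using q by (auto simp: takano_space_def)
  show ?thesis
    using invariant_christoffel[OF D inv a, of "(1, 0)" "snd q" "affine_scaling (1 / sqrt (fst q)) u"
        "affine_scaling (1 / sqrt (fst q)) v"]
    by (simp add: takano_space_def affine_action_origin[OF q] affine_scaling_inverse[OF a])
qed

lemma difference_tensor_from_origin:
  assumes q: "q \<in> takano_space"
  shows "difference_tensor D q u v = affine_scaling (sqrt (fst q))
    (difference_tensor D (1, 0) (affine_scaling (1 / sqrt (fst q)) u) (affine_scaling (1 / sqrt (fst q)) v))"
  unfolding difference_tensor_def christoffel_from_origin[OF q, of u v] alpha_christoffel_from_origin[OF q, of 0 u v]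
  by (simp add: linear_diff[OF bounded_linear.linear[OF bounded_linear_affine_scaling]])

text \<open>
  The Codazzi equation is evaluated at the point \<open>(1, 0)\<close> for the vectors \<open>e = (1, 0)\<close> and \<open>h m = (0, m)\<close>
  in the first two arguments. By invariance the derivatives of \<open>K\<close> are known there: \<open>e\<close> and \<open>h m\<close> are
  eigenvectors of the scalings, so the components of \<open>K\<close> are powers of the variance times their values at
  \<open>(1, 0)\<close>.
\<close>

lemma alpha_christoffel_if_conjugate_symmetric:
  assumes conj: "conjugate_symmetric takano_space fisher_metric D"
  shows "\<exists>\<alpha>. \<forall>p\<in>takano_space. \<forall>u v. christoffel D p u v = alpha_christoffel \<alpha> p u v"
proof -
  let ?o = "(1, 0) :: real \<times> (real ^ 'n)"
  let ?A = "alpha_christoffel 0 ?o"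
  define e :: "real \<times> (real ^ 'n)" where "e = (1, 0)"
  define h :: "real ^ 'n \<Rightarrow> real \<times> (real ^ 'n)" where "h m = (0, m)" for m
  define K where "K = difference_tensor D ?o"
  define \<kappa> where "\<kappa> = fst (K e e)"
  have o: "?o \<in> takano_space"
    by (simp add: takano_space_def)
  have K: "bilinear K" and K_commute: "K u v = K v u"
    and K_symmetric: "fisher_metric ?o (K u v) w = fisher_metric ?o (K u w) v" for u v w
    unfolding K_def by (rule bilinear_difference[OF D o] difference_commute[OF D o]
        difference_totally_symmetric[OF D o])+
  note K_simps = bilinear_ladd[OF K] bilinear_radd[OF K] bilinear_lmul[OF K] bilinear_rmul[OF K]
  note Codazzi = conjugate_symmetric_Codazzi[OF D conj o, folded K_def]
  have scale: "affine_scaling a e = a\<^sup>2 *\<^sub>R e" "affine_scaling a (h m) = a *\<^sub>R h m" for a m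
    by (simp_all add: affine_scaling_def e_def h_def)
  have diff: "(\<lambda>q. difference_tensor D q u v) differentiable (at ?o)" for u v
    unfolding difference_tensor_def
    by (intro differentiable_diff christoffel_differentiable[OF open_takano_space affine_conn[OF D] o]
        differentiableI[OF alpha_christoffel_has_derivative[OF o]])
  have mean_direction: "frechet_derivative (\<lambda>q. difference_tensor D q u v) (at ?o) (h m) = 0" for u v m
    unfolding h_def
    by (rule frechet_derivative_mean_direction[OF o diff difference_tensor_from_origin])
  have he: "frechet_derivative (\<lambda>q. difference_tensor D q (h m) e) (at ?o) e =
      (- fst (K (h m) e) / 2, - snd (K (h m) e))" for m
  proof -
    have "difference_tensor D q (h m) e =
        (1 / sqrt (fst q) * fst (K (h m) e), (1 / fst q) *\<^sub>R snd (K (h m) e))" if "q \<in> takano_space" for q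
    proof -
      have "fst q > 0" using that by (auto simp: takano_space_def)
      then show ?thesis
        unfolding difference_tensor_from_origin[OF that] scale K_def[symmetric] K_simps
        by (simp add: affine_scaling_def power_divide)
    qed
    moreover have "((\<lambda>q. (1 / sqrt (fst q) * fst (K (h m) e), (1 / fst q) *\<^sub>R snd (K (h m) e))) has_derivative
        (\<lambda>w. (- fst w / 2 * fst (K (h m) e), (- fst w) *\<^sub>R snd (K (h m) e)))) (at ?o)"
      by (auto intro!: derivative_eq_intros simp: field_simps)
    ultimately have "((\<lambda>q. difference_tensor D q (h m) e) has_derivative
        (\<lambda>w. (- fst w / 2 * fst (K (h m) e), (- fst w) *\<^sub>R snd (K (h m) e)))) (at ?o)"
      by (subst has_derivative_cong_on[OF open_takano_space o])
    from frechet_derivative_eq[OF this] show ?thesis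
      by (simp add: e_def)
  qed
  have hh: "frechet_derivative (\<lambda>q. difference_tensor D q (h m) (h m')) (at ?o) e =
      (0, - (1 / 2) *\<^sub>R snd (K (h m) (h m')))" for m m'
  proof -
    have "difference_tensor D q (h m) (h m') =
        (fst (K (h m) (h m')), (1 / sqrt (fst q)) *\<^sub>R snd (K (h m) (h m')))" if "q \<in> takano_space" for q
    proof -
      have "fst q > 0" using that by (auto simp: takano_space_def)
      then show ?thesis
        unfolding difference_tensor_from_origin[OF that] scale K_def[symmetric] K_simps
        by (simp add: affine_scaling_def power_divide)
          (simp add: field_simps)
    qed
    moreover have "((\<lambda>q. (fst (K (h m) (h m')), (1 / sqrt (fst q)) *\<^sub>R snd (K (h m) (h m')))) has_derivative
        (\<lambda>w. (0, (- fst w / 2) *\<^sub>R snd (K (h m) (h m'))))) (at ?o)"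
      by (auto intro!: derivative_eq_intros simp: field_simps)
    ultimately have "((\<lambda>q. difference_tensor D q (h m) (h m')) has_derivative
        (\<lambda>w. (0, (- fst w / 2) *\<^sub>R snd (K (h m) (h m'))))) (at ?o)"
      by (subst has_derivative_cong_on[OF open_takano_space o])
    from frechet_derivative_eq[OF this] show ?thesis
      by (simp add: e_def)
  qed
  have Ae: "?A e u = (- fst u, - (1 / 2) *\<^sub>R snd u)" for u
    by (simp add: alpha_christoffel_def e_def)
  have Ah: "?A (h m) u = ((m \<bullet> snd u) / real CARD('n), (- fst u / 2) *\<^sub>R m)" for m u
    by (simp add: alpha_christoffel_def h_def)
  have split: "u = fst u *\<^sub>R e + h (snd u)" for u
    by (simp add: e_def h_def prod_eq_iff)
  have Kee: "K e e = \<kappa> *\<^sub>R e" and Khe: "K (h m) e = h ((\<kappa> / 2) *\<^sub>R m)" for m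
  proof -
    have A1: "?A (h m) e = (- 1 / 2) *\<^sub>R h m" and A2: "?A e e = - 1 *\<^sub>R e" for m
      by (simp_all add: Ah Ae) (simp_all add: e_def h_def)
    \<comment> \<open>The Codazzi equation for \<open>e\<close>, \<open>h m\<close> and third argument \<open>e\<close>. Its second component determines
      the second component of \<open>K (h m) e\<close>; its first component conflicts with the total symmetry of \<open>g(K(u, v), w)\<close>
      unless both \<open>fst (K (h m) e)\<close> and \<open>snd (K e e)\<close> vanish.\<close>
    have *: "(- fst (K (h m) e) / 2, - snd (K (h m) e)) + ?A e (K (h m) e) + (- 1 / 2) *\<^sub>R K e (h m) =
        ?A (h m) (K e e) + (- 1) *\<^sub>R K (h m) e" for m
      using Codazzi[of "h m" e e] unfolding he mean_direction A1 A2 bilinear_rmul[OF K] by simp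
    have s: "fst (K (h m) e) = - (m \<bullet> snd (K e e)) / real CARD('n)"
      and v: "snd (K (h m) e) = (\<kappa> / 2) *\<^sub>R m" for m
      using *[of m] K_commute[of e "h m"]
      by (simp_all add: Ae Ah prod_eq_iff vec_eq_iff \<kappa>_def field_simps)
    have g: "snd (K e e) \<bullet> m = real CARD('n) / 2 * fst (K (h m) e)" for m
      using K_symmetric[of e e "h m"] K_commute[of e "h m"]
      by (simp add: fisher_metric_eq[OF o]) (simp add: e_def h_def)
    have z: "snd (K e e) \<bullet> m = 0" for m
      using s[of m] g[of m] by (simp add: inner_commute field_simps)
    then have "snd (K e e) = 0"
      by (metis inner_eq_zero_iff)
    then show "K e e = \<kappa> *\<^sub>R e"
      by (simp add: \<kappa>_def e_def prod_eq_iff)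
    show "K (h m) e = h ((\<kappa> / 2) *\<^sub>R m)" for m
      using s[of m] v[of m] z[of m] by (simp add: h_def prod_eq_iff inner_commute)
  qed
  have Khh: "K (h m) (h m') = (\<kappa> * (m \<bullet> m') / real CARD('n)) *\<^sub>R e" for m m'
  proof -
    have "fisher_metric ?o (K (h m) (h m')) e = fisher_metric ?o (h ((\<kappa> / 2) *\<^sub>R m)) (h m')"
      using K_symmetric[of "h m" "h m'" e] Khe by simp
    then have s: "fst (K (h m) (h m')) = \<kappa> * (m \<bullet> m') / real CARD('n)"
      unfolding fisher_metric_eq[OF o] by (simp add: e_def h_def field_simps)
    have A1: "?A (h m) (h m') = ((m \<bullet> m') / real CARD('n)) *\<^sub>R e" and A2: "?A e (h m') = (- 1 / 2) *\<^sub>R h m'"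
      by (simp_all add: Ah Ae) (simp_all add: e_def h_def)
    \<comment> \<open>The second component of the Codazzi equation for \<open>e\<close>, \<open>h m\<close> and third argument \<open>h m'\<close>: the three
      multiples of \<open>snd (K (h m) (h m'))\<close> add up to a nonzero one.\<close>
    have "(0, - (1 / 2) *\<^sub>R snd (K (h m) (h m'))) + ?A e (K (h m) (h m')) +
        ((m \<bullet> m') / real CARD('n)) *\<^sub>R K e e = ?A (h m) (K e (h m')) + (- 1 / 2) *\<^sub>R K (h m) (h m')"
      using Codazzi[of "h m" "h m'" e] unfolding hh mean_direction A1 A2 bilinear_rmul[OF K] by simp
    then have "snd (K (h m) (h m')) = 0"
      unfolding K_commute[of e "h m'"] Khe Kee Ae Ah
      by (simp add: prod_eq_iff vec_eq_iff e_def h_def)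
    with s show ?thesis
      by (simp add: e_def prod_eq_iff)
  qed
  have origin: "K u v = alpha_christoffel (- \<kappa>) ?o u v - ?A u v" for u v
  proof -
    have "K u v = K (fst u *\<^sub>R e + h (snd u)) (fst v *\<^sub>R e + h (snd v))"
      using split by metis
    also have "\<dots> = (fst u * fst v * \<kappa>) *\<^sub>R e + h ((\<kappa> / 2) *\<^sub>R (fst u *\<^sub>R snd v + fst v *\<^sub>R snd u)) +
        (\<kappa> * (snd u \<bullet> snd v) / real CARD('n)) *\<^sub>R e"
      unfolding K_simps K_commute[of e "h _"] Khe Kee Khh
      by (simp add: e_def h_def prod_eq_iff vec_eq_iff algebra_simps)
    also have "\<dots> = alpha_christoffel (- \<kappa>) ?o u v - ?A u v"
      by (simp add: alpha_christoffel_def e_def h_def prod_eq_iff vec_eq_iff field_simps)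
    finally show ?thesis .
  qed
  have "christoffel D ?o u v = alpha_christoffel (- \<kappa>) ?o u v" for u v
    using origin[of u v] by (simp add: K_def difference_tensor_def)
  then have "christoffel D q u v = alpha_christoffel (- \<kappa>) q u v" if "q \<in> takano_space" for q u v
    unfolding christoffel_from_origin[OF that, of u v] alpha_christoffel_from_origin[OF that, of _ u v]
    by simp
  then show ?thesis by blast
qed

end

theorem corollary1p4:
  fixes D :: "(real \<times> (real ^ 'n)) conn"
  assumes "statistical_structure takano_space fisher_metric D"
  shows "(\<exists>\<alpha>. amari_chentsov_connection \<alpha> D) \<longleftrightarrow>
         conjugate_symmetric takano_space fisher_metric D \<and>
         invariant_connection takano_space affine_group D"
  unfolding amari_chentsov_iff_christoffel[OF assms]
  using conjugate_symmetric_if_alpha[OF assms] invariant_if_alpha[OF assms]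
    alpha_christoffel_if_conjugate_symmetric[OF assms] by blast

end
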